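(* The function $\mathbf{P}\colon\mathcal{M}_2\times(0,+\infty)\to[-\infty,+\infty)$ is discontinuous at $(\mu,s)$ if and only if $s=1$ and $\mathbf{P}(\mu,1)>\mathbf{P}(\mu^0,1)$.
   Context: $M_2(\mathbb{R})$ is the space of real $2\times2$ matrices with the operator norm $\|\cdot\|$ induced by the Euclidean norm; $\sigma_1(A)\geq\sigma_2(A)$ are the singular values of $A$. For $s>0$: $\varphi^s(A):=\sigma_1(A)^s$ if $0<s\leq1$; $\varphi^s(A):=\sigma_1(A)\sigma_2(A)^{s-1}$ if $1\leq s\leq2$ (with $0^0:=1$); $\varphi^s(A):=|\det A|^{s/2}$ if $s\geq2$. For a Borel measure $\mu$ on $M_2(\mathbb{R})$ and $n\ge1$, $\mu_n$ is the push-forward of the $n$-fold product $\mu\times\cdots\times\mu$ under $(A_1,\ldots,A_n)\mapsto A_1\cdots A_n$. If $\int\varphi^s\,d\mu<\infty$, the singular value pressure is $\mathbf{P}(\mu,s):=\lim_{n\to\infty}\frac1n\log\left(\int\varphi^s(A)\,d\mu_n(A)\right)\in[-\infty,+\infty)$ (the limit exists by subadditivity; $\log0:=-\infty$). $\mathcal{M}_2$ is the set of Borel probability measures on the closed unit ball of $M_2(\mathbb{R})$ with the weak-* topology (the smallest topology making $\mu\mapsto\int f\,d\mu$ continuous for every real-valued continuous $f$ on the closed unit ball). For $\mu\in\mathcal{M}_2$, $\mu^0$ is the (not necessarily probability) measure $\mu^0(X):=\mu(\{A\in X:\det A\neq0\})$. *)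

theory Defs
  imports "HOL-Probability.Probability"
begin

type_synonym mat2 = "real^2^2"

text \<open>The norm that the library puts on \<^typ>\<open>mat2\<close> is the Frobenius norm; the operator norm
  is therefore written explicitly.\<close>

definition op_norm :: "mat2 \<Rightarrow> real" where
  "op_norm A = onorm ((*v) A)"

definition op_ball :: "mat2 set" where
  "op_ball = {A. op_norm A \<le> 1}"

text \<open>The singular values are the square roots of the eigenvalues of \<open>A\<^sup>T A\<close>. In dimension two
  a double eigenvalue is at the same time the largest and the smallest one, so taking \<open>Max\<close> and
  \<open>Min\<close> of the set of eigenvalues accounts for multiplicity.\<close>

definition gram_eigenvalues :: "mat2 \<Rightarrow> real set" where
  "gram_eigenvalues A = {l. \<exists>v. v \<noteq> 0 \<and> (transpose A ** A) *v v = l *\<^sub>R v}"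

definition sigma1 :: "mat2 \<Rightarrow> real" where
  "sigma1 A = sqrt (Max (gram_eigenvalues A))"

definition sigma2 :: "mat2 \<Rightarrow> real" where
  "sigma2 A = sqrt (Min (gram_eigenvalues A))"

text \<open>Only used for \<open>s > 0\<close>. In the library \<open>0 powr 0 = 0\<close>, but the second branch is only reached
  when \<open>s - 1 > 0\<close>. For \<open>s = 1\<close> the value is \<open>sigma1 A\<close>, which is what both formulas give under the
  convention \<open>0\<^sup>0 = 1\<close>; for \<open>s = 2\<close> the last two formulas agree because
  \<open>\<bar>det A\<bar> = sigma1 A * sigma2 A\<close>.\<close>

definition svf :: "real \<Rightarrow> mat2 \<Rightarrow> real" where
  "svf s A =
     (if s \<le> 1 then sigma1 A powr s
      else if s \<le> 2 then sigma1 A * sigma2 A powr (s - 1)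
      else \<bar>det A\<bar> powr (s / 2))"

text \<open>\<open>A\<^sub>1 \<cdots> A\<^sub>n\<close>, in this order.\<close>

definition word_product :: "nat \<Rightarrow> (nat \<Rightarrow> mat2) \<Rightarrow> mat2" where
  "word_product n A = foldr (**) (map A [1..<Suc n]) (mat 1)"

definition product_law :: "mat2 measure \<Rightarrow> nat \<Rightarrow> mat2 measure" where
  "product_law \<mu> n = distr (Pi\<^sub>M {1..n} (\<lambda>_. \<mu>)) borel (word_product n)"

definition ln_ext :: "ennreal \<Rightarrow> ereal" where
  "ln_ext x = (if x = 0 then -\<infinity> else if x = \<infinity> then \<infinity> else ereal (ln (enn2real x)))"

text \<open>Meaningful for \<open>s > 0\<close> and \<open>\<integral>\<^sup>+A. svf s A \<partial>\<mu> < \<infinity>\<close>, when the limit exists by subadditivity.\<close>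

definition pressure :: "mat2 measure \<Rightarrow> real \<Rightarrow> ereal" where
  "pressure \<mu> s =
     lim (\<lambda>n. ereal (1 / real n) * ln_ext (\<integral>\<^sup>+A. ennreal (svf s A) \<partial>product_law \<mu> n))"

text \<open>A Borel probability measure on the closed unit ball is represented by its extension by zero,
  that is, by a Borel probability measure on the whole matrix space which gives the ball full mass.\<close>

definition ball_measures :: "mat2 measure set" where
  "ball_measures = {\<mu>. sets \<mu> = sets borel \<and> prob_space \<mu> \<and> emeasure \<mu> op_ball = 1}"

text \<open>The functions \<open>f\<close> need only be continuous on the ball, hence the set integral.\<close>

definition weak_star :: "mat2 measure topology" where
  "weak_star = topology_generated_by
     {{\<mu> \<in> ball_measures. (LINT A:op_ball|\<mu>. f A) \<in> U} | f U.
        continuous_on op_ball (f :: mat2 \<Rightarrow> real) \<and> open U}"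

definition invertible_part :: "mat2 measure \<Rightarrow> mat2 measure" where
  "invertible_part \<mu> =
     measure_of (space \<mu>) (sets \<mu>) (\<lambda>X. emeasure \<mu> {A \<in> X. det A \<noteq> 0})"

lemma topspace_weak_star: "topspace weak_star = ball_measures"
proof -
  have "ball_measures = {\<mu> \<in> ball_measures. (LINT A:op_ball|\<mu>. (0::real)) \<in> UNIV}" by simp
  then have "ball_measures \<in> {{\<mu> \<in> ball_measures. (LINT A:op_ball|\<mu>. f A) \<in> U} | f U.
        continuous_on op_ball (f :: mat2 \<Rightarrow> real) \<and> open U}"
    using continuous_on_const[of op_ball "0::real"] open_UNIV by blast
  then show ?thesis
    unfolding weak_star_def topology_generated_by_topspace by blast
qed

text \<open>The set function in \<open>invertible_part\<close> is a measure (otherwise \<open>measure_of\<close> would silently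
  return the null measure).\<close>

lemma invertible_part_eq_density:
  assumes "sets \<mu> = sets borel"
  shows "invertible_part \<mu> = density \<mu> (indicator {A. det A \<noteq> 0})"
proof -
  have sp: "space \<mu> = UNIV"
    using sets_eq_imp_space_eq[OF assms] by simp
  have "continuous_on UNIV (det :: mat2 \<Rightarrow> real)"
    unfolding det_2 by (intro continuous_intros)
  then have "open {A :: mat2. det A \<noteq> 0}"
    by (intro open_Collect_neq continuous_intros) auto
  then have S: "{A. det A \<noteq> 0} \<in> sets \<mu>"
    using assms by auto
  have E: "emeasure (density \<mu> (indicator {A. det A \<noteq> 0})) X = emeasure \<mu> {A \<in> X. det A \<noteq> 0}"
    if X: "X \<in> sets \<mu>" for X
  proof -
    have "(\<lambda>x. indicator {A. det A \<noteq> 0} x * indicator X x :: ennreal)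
        = indicator {A \<in> X. det A \<noteq> 0}"
      by (auto simp: indicator_def)
    moreover have "{A \<in> X. det A \<noteq> 0} \<in> sets \<mu>"
      using sets.Int[OF X S] by (simp add: Int_def)
    ultimately show ?thesis
      using S X by (simp add: emeasure_density)
  qed
  have "density \<mu> (indicator {A. det A \<noteq> 0}) =
      measure_of (space \<mu>) (sets \<mu>) (emeasure (density \<mu> (indicator {A. det A \<noteq> 0})))"
    by (metis measure_of_of_measure space_density sets_density)
  also have "\<dots> = invertible_part \<mu>"
    unfolding invertible_part_def
    by (intro measure_of_eq) (auto simp: E sets.space_closed sets.sigma_sets_eq)
  finally show ?thesis ..
qed

end

theory Submission
  imports Defs
begin

text \<open>The pressure is the exponential growth rate of \<open>\<integral> \<phi>\<^sup>s d\<mu>\<^sub>n\<close>. For \<open>s < 2\<close> the integrand is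
a multiplicative weight times a power of the norm with an exponent \<open>r \<in> (0, 1]\<close>: the weight is
\<open>1\<close> and \<open>r = s\<close> if \<open>s \<le> 1\<close>, while \<open>\<phi>\<^sup>s(A) = \<bar>det A\<bar>\<^sup>s\<^sup>-\<^sup>1 \<sigma>\<^sub>1(A)\<^sup>2\<^sup>-\<^sup>s\<close>, so that \<open>r = 2 - s\<close>, if
\<open>1 < s < 2\<close>. A multiplicative weight can be absorbed into the measure. So for \<open>s < 2\<close> everything
is about the growth rate \<open>\<Lambda>(N, r)\<close> of the sum of
\<open>\<integral> \<bar>A\<^sub>1 \<cdots> A\<^sub>n v\<bar>\<^sup>r dN(A\<^sub>1) \<cdots> dN(A\<^sub>n)\<close> over the vectors \<open>v\<close> of a basis, for a measure \<open>N\<close> of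
mass at most \<open>1\<close> on the linear contractions of the plane.

The rate \<open>\<Lambda>\<close> is continuous in \<open>(N, r)\<close> as long as \<open>r\<close> stays positive. It is an infimum of
continuous functions, because the integrals are submultiplicative in \<open>n\<close> and for each \<open>n\<close> depend
continuously on \<open>(N, r)\<close>; this gives upper semicontinuity. Lower semicontinuity
(\<open>growth_lower_semicontinuous\<close>) is the heart of the matter, and there are two cases. If no line
is invariant under almost every matrix, then \<open>\<integral> \<bar>v \<and> A v\<bar> dN(A)\<close> is bounded below uniformly over
unit vectors \<open>v\<close>, the bound survives small perturbations of \<open>N\<close>, and it makes the integrals
\<^emph>\<open>super\<close>multiplicative up to a constant. A single large \<open>n\<close> then certifies a lower bound for the
rate near \<open>N\<close>. If some line is invariant, the matrices are triangular in an adapted frame, and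
the rate is the larger one of the \<open>r\<close>-th moments \<open>\<alpha>\<close>, \<open>\<delta>\<close> of the two diagonal entries. For every
positive \<open>c < max \<alpha> \<delta>\<close> other than \<open>\<alpha>\<close> and \<open>\<delta>\<close> an explicit function \<open>F(x) = max 0 (p\<bar>x\<^sub>1\<bar>\<^sup>r +
q\<bar>x\<^sub>2\<bar>\<^sup>r)\<close> satisfies \<open>\<integral> F(A v) dN(A) \<ge> c F(v)\<close>, and does so with room to spare, hence also after
a perturbation that destroys the invariant line; such a function, positive somewhere, forces
growth at rate at least \<open>c\<close>.

It remains to see how the weights depend on \<open>s\<close>. Continuity for \<open>s < 1\<close>, for \<open>1 < s < 2\<close> and for
\<open>s \<rightarrow> 1\<close> from below follows at once. For \<open>s \<ge> 2\<close> the function \<open>\<phi>\<^sup>s\<close> is itself multiplicative and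
the pressure is \<open>log \<integral> \<bar>det A\<bar>\<^sup>s\<^sup>/\<^sup>2 d\<mu>\<close>; for \<open>s \<rightarrow> 2\<close> from below it is squeezed between the
logarithms of two such integrals. For \<open>s \<rightarrow> 1\<close> from above the weight \<open>\<bar>det A\<bar>\<^sup>s\<^sup>-\<^sup>1\<close> does not
tend to \<open>1\<close> but to the indicator of the invertible matrices. The limit of \<open>P(\<mu>, s)\<close> for \<open>s \<rightarrow> 1\<close>
from above is therefore \<open>P(\<mu>\<^sup>0, 1)\<close>, and the pressure jumps exactly if this is less than \<open>P(\<mu>,
1)\<close>.\<close>

section \<open>Powers with exponent at most one\<close>

lemma powr_add_le:
  fixes x y r :: real
  assumes "0 \<le> x" "0 \<le> y" "0 < r" "r \<le> 1"
  shows "(x + y) powr r \<le> x powr r + y powr r"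
proof (cases "x + y = 0")
  case True
  with assms have "x = 0" "y = 0" by auto
  then show ?thesis by simp
next
  case False
  then have s: "x + y > 0" using assms by linarith
  have "x / (x + y) \<le> (x / (x + y)) powr r" "y / (x + y) \<le> (y / (x + y)) powr r"
    using powr_mono'[of r 1 "x / (x + y)"] powr_mono'[of r 1 "y / (x + y)"] assms s by auto
  moreover have "x / (x + y) + y / (x + y) = 1"
    using s by (simp add: add_divide_distrib[symmetric])
  ultimately have "1 \<le> x powr r / (x + y) powr r + y powr r / (x + y) powr r"
    using assms s by (simp add: powr_divide)
  then show ?thesis using s by (simp add: add_divide_distrib[symmetric] pos_le_divide_eq)
qed

lemma powr_abs_add_le:
  fixes x y r :: real
  assumes "0 < r" "r \<le> 1"
  shows "\<bar>x + y\<bar> powr r \<le> \<bar>x\<bar> powr r + \<bar>y\<bar> powr r"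
proof -
  have "\<bar>x + y\<bar> powr r \<le> (\<bar>x\<bar> + \<bar>y\<bar>) powr r"
    using assms by (intro powr_mono2) auto
  also have "\<dots> \<le> \<bar>x\<bar> powr r + \<bar>y\<bar> powr r"
    using assms by (intro powr_add_le) auto
  finally show ?thesis .
qed

lemma norm_powr_add_le:
  fixes x y :: "'a::real_normed_vector"
  assumes "0 < r" "r \<le> 1"
  shows "norm (x + y) powr r \<le> norm x powr r + norm y powr r"
proof -
  have "norm (x + y) powr r \<le> (norm x + norm y) powr r"
    using assms by (intro powr_mono2) (auto simp: norm_triangle_ineq)
  also have "\<dots> \<le> norm x powr r + norm y powr r"
    using assms by (intro powr_add_le) auto
  finally show ?thesis .
qed

lemma scaled_powr_add_ge:
  fixes p x y r :: real
  assumes "0 < r" "r \<le> 1"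
  shows "p * \<bar>x\<bar> powr r - \<bar>p\<bar> * \<bar>y\<bar> powr r \<le> p * \<bar>x + y\<bar> powr r"
proof (cases "0 \<le> p")
  case True
  have "\<bar>x\<bar> powr r \<le> \<bar>x + y\<bar> powr r + \<bar>y\<bar> powr r"
    using powr_abs_add_le[of r "x + y" "- y"] assms by simp
  from mult_left_mono[OF this True] True show ?thesis by (simp add: distrib_left)
next
  case False
  have "p * (\<bar>x\<bar> powr r + \<bar>y\<bar> powr r) \<le> p * \<bar>x + y\<bar> powr r"
    using powr_abs_add_le[of r x y] assms False by (intro mult_left_mono_neg) auto
  with False show ?thesis by (simp add: distrib_left)
qed

lemma continuous_abs_powr: "continuous_on UNIV e \<Longrightarrow> 0 < r \<Longrightarrow> continuous_on UNIV (\<lambda>A. \<bar>e A\<bar> powr r)"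
  for e :: "'a::topological_space \<Rightarrow> real"
  by (intro continuous_on_powr' continuous_intros) auto

text \<open>With \<open>x = e\<^sup>-\<^sup>u\<close> the difference is \<open>e\<^sup>-\<^sup>p\<^sup>u (1 - e\<^sup>-\<^sup>(\<^sup>q\<^sup>-\<^sup>p\<^sup>)\<^sup>u)\<close>; the second factor is
at most \<open>(q - p) u\<close>, and \<open>p u e\<^sup>-\<^sup>p\<^sup>u \<le> 1\<close>.\<close>

lemma powr_exponent_diff_le:
  fixes x p q :: real
  assumes "0 \<le> x" "x \<le> 1" "0 < p" "p \<le> q"
  shows "x powr p - x powr q \<le> (q - p) / p"
proof (cases "x = 0")
  case True
  then show ?thesis using assms by simp
next
  case False
  define u where "u = - ln x"
  have u: "0 \<le> u" using False assms by (simp add: u_def)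
  have "x powr p - x powr q = exp (- (p * u)) * (1 - exp (- ((q - p) * u)))"
    using False assms by (simp add: powr_def u_def right_diff_distrib exp_add[symmetric] algebra_simps)
  also have "\<dots> \<le> exp (- (p * u)) * ((q - p) * u)"
    using exp_ge_add_one_self[of "- ((q - p) * u)"] by (intro mult_left_mono) auto
  also have "\<dots> = ((q - p) / p) * (exp (- (p * u)) * (p * u))"
    using assms by simp
  also have "\<dots> \<le> ((q - p) / p) * 1"
  proof (intro mult_left_mono)
    have "p * u \<le> exp (p * u)" using exp_ge_add_one_self[of "p * u"] by linarith
    then show "exp (- (p * u)) * (p * u) \<le> 1"
      by (simp add: exp_minus field_simps)
  qed (use assms in auto)
  finally show ?thesis by simp
qed

text \<open>Positivity of the limit exponent is essential: as the exponent tends to \<open>0\<close>, the powers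
converge to the indicator of \<open>(0, 1]\<close>, and not uniformly. Applied to \<open>\<bar>det A\<bar>\<close>, this is the
source of the discontinuities of the pressure.\<close>

lemma uniform_limit_powr_exponent:
  assumes "(p \<longlongrightarrow> q) F" "(0::real) < q"
  shows "uniform_limit {0..1} (\<lambda>i x. x powr p i) (\<lambda>x. x powr q) F"
proof (rule uniform_limitI)
  fix e :: real assume e: "0 < e"
  have "eventually (\<lambda>i. dist (p i) q < min (q / 2) (e * (q / 2))) F"
    using assms e by (intro tendstoD[OF assms(1)]) auto
  then show "\<forall>\<^sub>F i in F. \<forall>x\<in>{0..1}. dist (x powr p i) (x powr q) < e"
  proof (eventually_elim, intro ballI)
    fix i x assume d: "dist (p i) q < min (q / 2) (e * (q / 2))" and x: "x \<in> {0..1::real}"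
    have "\<bar>p i - q\<bar> < q / 2" using d by (simp add: dist_real_def)
    then have p: "p i > q / 2" by linarith
    have "\<bar>x powr p i - x powr q\<bar> \<le> \<bar>p i - q\<bar> / (q / 2)"
    proof (cases "p i \<le> q")
      case True
      have "\<bar>x powr p i - x powr q\<bar> = x powr p i - x powr q"
        using powr_mono'[of "p i" q x] True x by auto
      also have "\<dots> \<le> (q - p i) / p i"
        using x True p assms by (intro powr_exponent_diff_le) auto
      also have "\<dots> \<le> (q - p i) / (q / 2)"
        using True p assms by (intro divide_left_mono) auto
      finally show ?thesis using True by simp
    next
      case False
      have "\<bar>x powr p i - x powr q\<bar> = x powr q - x powr p i"
        using powr_mono'[of q "p i" x] False x by auto
      also have "\<dots> \<le> (p i - q) / q"
        using x False p assms by (intro powr_exponent_diff_le) auto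
      also have "\<dots> \<le> (p i - q) / (q / 2)"
        using False p assms by (intro divide_left_mono) auto
      finally show ?thesis using False by simp
    qed
    also have "\<dots> < e"
      using d assms by (auto simp: dist_real_def field_simps)
    finally show "dist (x powr p i) (x powr q) < e" by (simp add: dist_real_def)
  qed
qed

text \<open>A finite net of points suffices, since equicontinuity controls the error in between.
Equicontinuity is only asked for eventually along the filter, separately for each \<open>e\<close>.\<close>

lemma uniform_limit_equicontinuous:
  fixes g :: "'i \<Rightarrow> 'a::metric_space \<Rightarrow> real"
  assumes C: "compact C"
    and eq: "\<And>e. 0 < e \<Longrightarrow> \<exists>d>0. \<forall>\<^sub>F i in F. \<forall>v\<in>C. \<forall>w\<in>C. dist v w < d \<longrightarrow> dist (g i v) (g i w) < e"
    and cont: "continuous_on C l"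
    and pt: "\<And>v. v \<in> C \<Longrightarrow> ((\<lambda>i. g i v) \<longlongrightarrow> l v) F"
  shows "uniform_limit C g l F"
proof (rule uniform_limitI)
  fix e :: real assume e: "0 < e"
  obtain d1 where d1: "d1 > 0"
    "\<forall>\<^sub>F i in F. \<forall>v\<in>C. \<forall>w\<in>C. dist v w < d1 \<longrightarrow> dist (g i v) (g i w) < e / 3"
    using eq[of "e / 3"] e by auto
  obtain d2 where d2: "d2 > 0" "\<And>v w. v \<in> C \<Longrightarrow> w \<in> C \<Longrightarrow> dist v w < d2 \<Longrightarrow> dist (l v) (l w) < e / 3"
    using compact_uniformly_continuous[OF cont C] e unfolding uniformly_continuous_on_def
    by (metis dist_commute divide_pos_pos zero_less_numeral)
  define d where "d = min d1 d2"
  have d: "d > 0" using d1 d2 by (simp add: d_def)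
  obtain D where D: "finite D" "D \<subseteq> C" "C \<subseteq> (\<Union>x\<in>D. ball x d)"
    using compactE_image[OF C, of C "\<lambda>x. ball x d"] d by (metis UN_I centre_in_ball open_ball subsetI)
  have "\<forall>\<^sub>F i in F. \<forall>x\<in>D. dist (g i x) (l x) < e / 3"
    using D e by (intro eventually_ball_finite ballI tendstoD[OF pt]) auto
  with d1(2) show "\<forall>\<^sub>F i in F. \<forall>v\<in>C. dist (g i v) (l v) < e"
  proof (eventually_elim, intro ballI)
    fix i v
    assume 1: "\<forall>v\<in>C. \<forall>w\<in>C. dist v w < d1 \<longrightarrow> dist (g i v) (g i w) < e / 3"
      and 2: "\<forall>x\<in>D. dist (g i x) (l x) < e / 3" and v: "v \<in> C"
    obtain x where x: "x \<in> D" "dist x v < d" using D v by auto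
    have "dist (g i v) (g i x) < e / 3" using 1 v x D by (auto simp: d_def dist_commute)
    moreover have "dist (l v) (l x) < e / 3" using d2(2)[of v x] v x D by (auto simp: d_def dist_commute)
    moreover have "dist (g i x) (l x) < e / 3" using 2 x by auto
    ultimately show "dist (g i v) (l v) < e"
      unfolding dist_real_def by linarith
  qed
qed

section \<open>The oriented area in the plane and the operator ball\<close>

definition wedge :: "real^2 \<Rightarrow> real^2 \<Rightarrow> real" where
  "wedge v w = v$1 * w$2 - v$2 * w$1"

abbreviation e1 :: "real^2" where "e1 \<equiv> axis 1 1"
abbreviation e2 :: "real^2" where "e2 \<equiv> axis 2 1"

lemma axis_components [simp]:
  "e1 $ 1 = 1" "e1 $ 2 = 0" "e2 $ 1 = 0" "e2 $ 2 = 1"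
  by (auto simp: axis_def)

lemma norm_sq_2: "(norm (v::real^2))\<^sup>2 = (v$1)\<^sup>2 + (v$2)\<^sup>2"
  unfolding power2_norm_eq_inner inner_vec_def sum_2 by (simp add: power2_eq_square)

lemma inner_2: "(v::real^2) \<bullet> w = v$1 * w$1 + v$2 * w$2"
  by (simp add: inner_vec_def sum_2)

lemma mult_vec_2:
  fixes A :: mat2
  shows "(A *v v) $ i = A$i$1 * v$1 + A$i$2 * v$2"
  by (simp add: matrix_vector_mult_def sum_2)

lemma wedge_sq_add_inner_sq: "(wedge v w)\<^sup>2 + (v \<bullet> w)\<^sup>2 = (norm v)\<^sup>2 * (norm w)\<^sup>2"
  unfolding norm_sq_2 inner_2 wedge_def by (simp add: power2_eq_square algebra_simps)

lemma abs_wedge_le: "\<bar>wedge v w\<bar> \<le> norm v * norm w"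
proof -
  have "\<bar>wedge v w\<bar>\<^sup>2 \<le> (norm v * norm w)\<^sup>2"
    using wedge_sq_add_inner_sq[of v w] zero_le_power2[of "v \<bullet> w"]
    by (simp only: power_mult_distrib power2_abs)
  then show ?thesis by (rule power2_le_imp_le) auto
qed

text \<open>Cramer's rule, multiplied by the determinant so that it also holds for dependent \<open>v\<close> and
\<open>w\<close>.\<close>

lemma wedge_scaleR_decomposition: "wedge v w *\<^sub>R x = wedge x w *\<^sub>R v + wedge v x *\<^sub>R w"
  by (simp add: vec_eq_iff forall_2 wedge_def algebra_simps)

lemma wedge_continuous [continuous_intros]:
  "continuous_on S f \<Longrightarrow> continuous_on S g \<Longrightarrow> continuous_on S (\<lambda>x. wedge (f x) (g x))"
  unfolding wedge_def by (intro continuous_intros)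

lemma mult_vec_continuous [continuous_intros]:
  fixes f :: "'a::topological_space \<Rightarrow> mat2"
  assumes "continuous_on S f" "continuous_on S g"
  shows "continuous_on S (\<lambda>x. f x *v g x)"
  unfolding matrix_vector_mult_def sum_2
  by (intro continuous_intros continuous_on_vec_lambda assms)

lemma mult_mat_continuous [continuous_intros]:
  fixes f :: "'a::topological_space \<Rightarrow> mat2" and g :: "'a::topological_space \<Rightarrow> mat2"
  assumes "continuous_on S f" "continuous_on S g"
  shows "continuous_on S (\<lambda>x. f x ** g x)"
  unfolding matrix_matrix_mult_def sum_2
  by (intro continuous_intros continuous_on_vec_lambda assms)

lemma det_continuous [continuous_intros]:
  fixes f :: "'a::topological_space \<Rightarrow> mat2"
  assumes "continuous_on S f"
  shows "continuous_on S (\<lambda>x. det (f x))"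
  unfolding det_2 by (intro continuous_intros assms)

lemma op_norm_bound: "norm (A *v v) \<le> op_norm A * norm v"
  unfolding op_norm_def by (rule onorm) simp

lemma op_ball_iff: "A \<in> op_ball \<longleftrightarrow> (\<forall>v. norm (A *v v) \<le> norm v)"
proof
  assume "A \<in> op_ball"
  then have "op_norm A \<le> 1" by (simp add: op_ball_def)
  then have "op_norm A * norm v \<le> norm v" for v :: "real^2"
    using mult_right_mono[of "op_norm A" 1 "norm v"] by simp
  then show "\<forall>v. norm (A *v v) \<le> norm v"
    using op_norm_bound[of A] order_trans by blast
next
  assume "\<forall>v. norm (A *v v) \<le> norm v"
  then show "A \<in> op_ball"
    unfolding op_ball_def op_norm_def using onorm_le[of "(*v) A" 1] by simp
qed

lemma compact_op_ball: "compact op_ball"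
proof -
  have "op_ball = (\<Inter>v. {A. norm (A *v v) \<le> norm v})"
    using op_ball_iff by auto
  moreover have "closed {A::mat2. norm (A *v v) \<le> norm v}" for v
    by (intro closed_Collect_le continuous_intros)
  ultimately have "closed op_ball" by (metis (no_types, lifting) closed_INT)
  moreover have "bounded op_ball"
  proof (rule boundedI)
    fix A :: mat2 assume A: "A \<in> op_ball"
    have b: "\<bar>A$i$j\<bar> \<le> 1" for i j
    proof -
      have "\<bar>A$i$j\<bar> = \<bar>(A *v axis j 1) $ i\<bar>"
        by (simp add: matrix_vector_mult_basis column_def)
      also have "\<dots> \<le> norm (A *v axis j 1)" by (rule component_le_norm_cart)
      also have "\<dots> \<le> norm (axis j 1 :: real^2)" using A op_ball_iff by blast
      finally show ?thesis by simp
    qed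
    have "norm A \<le> (\<Sum>i\<in>UNIV. norm (A$i))"
      unfolding norm_vec_def by (rule L2_set_le_sum) simp
    also have "\<dots> \<le> (\<Sum>i\<in>UNIV. (\<Sum>j\<in>UNIV. \<bar>A$i$j\<bar>))"
      by (intro sum_mono norm_le_l1_cart)
    also have "\<dots> \<le> 4" using b[of 1 1] b[of 1 2] b[of 2 1] b[of 2 2] by (simp add: sum_2)
    finally show "norm A \<le> 4" .
  qed
  ultimately show ?thesis using compact_eq_bounded_closed by blast
qed

lemma det_eq_wedge_columns: "det A = wedge (A *v e1) (A *v e2)"
  by (simp add: det_2 wedge_def mult_vec_2 algebra_simps)

lemma abs_det_le_1: "A \<in> op_ball \<Longrightarrow> \<bar>det A\<bar> \<le> 1"
proof -
  assume A: "A \<in> op_ball"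
  have "norm (A *v e1) \<le> norm e1" "norm (A *v e2) \<le> norm e2"
    using A op_ball_iff by blast+
  then have "norm (A *v e1) \<le> 1" "norm (A *v e2) \<le> 1" by simp_all
  then have "norm (A *v e1) * norm (A *v e2) \<le> 1"
    by (simp add: mult_le_one)
  then show ?thesis unfolding det_eq_wedge_columns using abs_wedge_le order_trans by blast
qed

section \<open>Moments of random products of contractions\<close>

locale contractive_measure = finite_measure N for N :: "mat2 measure" +
  assumes sets_N [measurable_cong]: "sets N = sets borel"
    and mass_le_1: "measure N (space N) \<le> 1"
    and AE_op_ball: "AE A in N. A \<in> op_ball"

text \<open>The \<open>n\<close>-th iterate of the transfer operator \<open>F \<mapsto> \<integral> F(A v) dN(A)\<close>, applied to \<open>\<bar>v\<bar>\<^sup>r\<close>. It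
equals \<open>\<integral> \<bar>A\<^sub>1 \<cdots> A\<^sub>n v\<bar>\<^sup>r dN(A\<^sub>1) \<cdots> dN(A\<^sub>n)\<close>; the recursion avoids product measures.\<close>

primrec moment :: "mat2 measure \<Rightarrow> real \<Rightarrow> nat \<Rightarrow> real^2 \<Rightarrow> real" where
  "moment N r 0 v = norm v powr r"
| "moment N r (Suc n) v = (\<integral>A. moment N r n (A *v v) \<partial>N)"

text \<open>The sum over a basis is comparable with \<open>\<integral> \<parallel>A\<^sub>1 \<cdots> A\<^sub>n\<parallel>\<^sup>r dN(A\<^sub>1) \<cdots> dN(A\<^sub>n)\<close>, up to a
factor \<open>2\<close>, and it is exactly submultiplicative.\<close>

definition basis_moment :: "mat2 measure \<Rightarrow> real \<Rightarrow> nat \<Rightarrow> real" where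
  "basis_moment N r n = moment N r n e1 + moment N r n e2"

text \<open>By submultiplicativity the growth rate is the infimum of the \<open>n\<close>-th roots of the basis
moments, so this says that the rate is at least \<open>c\<close>, without a limit or a logarithm.\<close>

definition growth_at_least :: "mat2 measure \<Rightarrow> real \<Rightarrow> real \<Rightarrow> bool" where
  "growth_at_least N r c \<longleftrightarrow> (\<forall>n. c ^ n \<le> basis_moment N r n)"

context contractive_measure
begin

lemma continuous_measurable: "continuous_on UNIV h \<Longrightarrow> h \<in> borel_measurable N"
  for h :: "mat2 \<Rightarrow> real"
  using borel_measurable_continuous_onI measurable_cong_sets[OF sets_N refl] by blast

lemma integrable_continuous: "continuous_on UNIV h \<Longrightarrow> integrable N h" for h :: "mat2 \<Rightarrow> real"
proof -
  assume h: "continuous_on UNIV h"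
  then have "bounded (h ` op_ball)"
    using compact_continuous_image[OF _ compact_op_ball] continuous_on_subset compact_imp_bounded
    by (metis subset_UNIV)
  then obtain B where "\<And>A. A \<in> op_ball \<Longrightarrow> norm (h A) \<le> B"
    by (auto simp: bounded_iff)
  then show ?thesis
    using AE_op_ball continuous_measurable[OF h] by (intro integrable_const_bound[of _ B]) auto
qed

lemma integral_le_const:
  fixes h :: "mat2 \<Rightarrow> real"
  assumes "continuous_on UNIV h" "\<And>A. A \<in> op_ball \<Longrightarrow> h A \<le> B" "0 \<le> B"
  shows "integral\<^sup>L N h \<le> B"
proof -
  have "integral\<^sup>L N h \<le> integral\<^sup>L N (\<lambda>_. B)"
    using AE_op_ball assms by (intro integral_mono_AE integrable_continuous) auto
  also have "\<dots> = measure N (space N) * B" by simp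
  also have "\<dots> \<le> B" using mass_le_1 assms(3) by (simp add: mult_left_le_one_le)
  finally show ?thesis .
qed

lemma integral_mono_op_ball:
  fixes h k :: "mat2 \<Rightarrow> real"
  assumes "continuous_on UNIV h" "continuous_on UNIV k" "\<And>A. A \<in> op_ball \<Longrightarrow> h A \<le> k A"
  shows "integral\<^sup>L N h \<le> integral\<^sup>L N k"
  using AE_op_ball assms by (intro integral_mono_AE integrable_continuous) auto

end

text \<open>The modulus of continuity depends on \<open>m\<close> only through \<open>r\<close>. This is what makes the moments
of different measures equicontinuous.\<close>

lemma subadditive_powr_dominated:
  fixes m :: "real^2 \<Rightarrow> real"
  assumes "0 < r" "\<And>v w. m (v + w) \<le> m v + m w" "\<And>v. m v \<le> norm v powr r"
  shows "\<bar>m v - m w\<bar> \<le> norm (v - w) powr r" "continuous_on UNIV m"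
proof -
  show b: "\<bar>m v - m w\<bar> \<le> norm (v - w) powr r" for v w
    using assms(2)[of w "v - w"] assms(2)[of v "w - v"] assms(3)[of "v - w"] assms(3)[of "w - v"]
    by (simp add: norm_minus_commute)
  have "isCont m v" for v
    unfolding isCont_def
  proof (rule LIM_zero_cancel, rule Lim_null_comparison)
    show "\<forall>\<^sub>F w in at v. norm (m w - m v) \<le> norm (w - v) powr r" using b by simp
    have "continuous_on UNIV (\<lambda>w. norm (w - v) powr r)"
      using assms(1) by (intro continuous_intros continuous_on_powr') auto
    then have "isCont (\<lambda>w. norm (w - v) powr r) v"
      by (simp add: continuous_on_eq_continuous_at)
    then show "((\<lambda>w. norm (w - v) powr r) \<longlongrightarrow> 0) (at v)" by (simp add: isCont_def)
  qed
  then show "continuous_on UNIV m" by (simp add: continuous_at_imp_continuous_on)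
qed

lemma continuous_orbit: "continuous_on UNIV m \<Longrightarrow> continuous_on UNIV (\<lambda>A::mat2. m (A *v v))"
  for m :: "real^2 \<Rightarrow> real"
  by (rule continuous_on_compose2[of UNIV m]) (auto intro!: continuous_intros)

locale contractive_moments = contractive_measure +
  fixes r :: real
  assumes r_pos: "0 < r" and r_le_1: "r \<le> 1"
begin

abbreviation "m \<equiv> moment N r"
abbreviation "b \<equiv> basis_moment N r"

lemma moment_basic:
  "0 \<le> m n v \<and> m n v \<le> norm v powr r \<and> m n (v + w) \<le> m n v + m n w
     \<and> m n (a *\<^sub>R v) = \<bar>a\<bar> powr r * m n v"
proof (induction n arbitrary: v w)
  case 0
  show ?case using norm_powr_add_le r_pos r_le_1 by (auto simp: powr_mult)
next
  case (Suc n)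
  have c: "continuous_on UNIV (m n)"
    using subadditive_powr_dominated(2)[OF r_pos, of "m n"] Suc.IH by blast
  have i: "continuous_on UNIV (\<lambda>A::mat2. m n (A *v v))" for v
    by (rule continuous_orbit[OF c])
  have "m (Suc n) v \<le> norm v powr r"
    unfolding moment.simps
  proof (rule integral_le_const[OF i])
    fix A assume "A \<in> op_ball"
    then have "norm (A *v v) powr r \<le> norm v powr r"
      using op_ball_iff r_pos by (intro powr_mono2) auto
    moreover have "m n (A *v v) \<le> norm (A *v v) powr r" using Suc.IH by blast
    ultimately show "m n (A *v v) \<le> norm v powr r" by linarith
  qed simp
  moreover have "m (Suc n) (v + w) \<le> (\<integral>A. m n (A *v v) + m n (A *v w) \<partial>N)"
    using Suc.IH i i[of "v + w"] unfolding moment.simps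
    by (intro integral_mono integrable_continuous continuous_on_add) (auto simp: matrix_vector_right_distrib)
  then have "m (Suc n) (v + w) \<le> m (Suc n) v + m (Suc n) w"
    using i by (simp add: integrable_continuous)
  moreover have "m (Suc n) (a *\<^sub>R v) = \<bar>a\<bar> powr r * m (Suc n) v"
    using Suc.IH by (simp add: matrix_vector_mult_scaleR)
  ultimately show ?case using Suc.IH by simp
qed

lemma moment_nonneg: "0 \<le> m n v" using moment_basic by blast
lemma moment_le_norm: "m n v \<le> norm v powr r" using moment_basic by blast
lemma moment_add_le: "m n (v + w) \<le> m n v + m n w" using moment_basic by blast
lemma moment_scaleR: "m n (a *\<^sub>R v) = \<bar>a\<bar> powr r * m n v" using moment_basic by blast

lemma moment_Holder: "\<bar>m n v - m n w\<bar> \<le> norm (v - w) powr r"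
  using subadditive_powr_dominated(1) r_pos moment_add_le moment_le_norm by blast

lemma moment_continuous: "continuous_on UNIV (m n)"
  using subadditive_powr_dominated(2) r_pos moment_add_le moment_le_norm by blast

lemma moment_orbit_continuous: "continuous_on UNIV (\<lambda>A::mat2. m n (A *v v))"
  by (rule continuous_orbit[OF moment_continuous])

lemma moment_Suc_le: "m (Suc n) v \<le> m n v"
proof (induction n arbitrary: v)
  case 0
  show ?case using moment_le_norm[of "Suc 0" v] by simp
next
  case (Suc n)
  have "m (Suc (Suc n)) v = (\<integral>A. m (Suc n) (A *v v) \<partial>N)" by simp
  also have "\<dots> \<le> (\<integral>A. m n (A *v v) \<partial>N)"
    by (intro integral_mono_op_ball moment_orbit_continuous Suc.IH)
  finally show ?case by simp
qed

lemma moment_le_basis: "m n v \<le> norm v powr r * b n"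
proof -
  have v: "v = v$1 *\<^sub>R e1 + v$2 *\<^sub>R e2" by (simp add: vec_eq_iff forall_2)
  have "m n v \<le> \<bar>v$1\<bar> powr r * m n e1 + \<bar>v$2\<bar> powr r * m n e2"
    using moment_add_le[of n "v$1 *\<^sub>R e1" "v$2 *\<^sub>R e2"] moment_scaleR v by metis
  also have "\<dots> \<le> norm v powr r * m n e1 + norm v powr r * m n e2"
    using r_pos moment_nonneg
    by (intro add_mono mult_right_mono powr_mono2 component_le_norm_cart) auto
  finally show ?thesis by (simp add: basis_moment_def distrib_left)
qed

lemma basis_moment_nonneg: "0 \<le> b n"
  using moment_nonneg by (simp add: basis_moment_def)

lemma basis_moment_0: "b 0 = 2"
  by (simp add: basis_moment_def)

text \<open>The case \<open>k = 0\<close> bounds the \<open>n\<close>-th moment by \<open>b n * \<bar>v\<bar>\<^sup>r\<close>; the transfer operator is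
monotone, so it can be applied \<open>k\<close> times to both sides.\<close>

lemma moment_add_index_le: "m (n + k) v \<le> b n * m k v"
proof (induction k arbitrary: v)
  case 0
  show ?case using moment_le_basis by (simp add: mult.commute)
next
  case (Suc k)
  have "m (n + Suc k) v = (\<integral>A. m (n + k) (A *v v) \<partial>N)" by simp
  also have "\<dots> \<le> (\<integral>A. b n * m k (A *v v) \<partial>N)"
    by (intro integral_mono_op_ball continuous_on_mult_left moment_orbit_continuous Suc.IH)
  finally show ?case by simp
qed

lemma basis_moment_submult: "b (n + k) \<le> b n * b k"
  using moment_add_index_le[of n k e1] moment_add_index_le[of n k e2]
  by (simp add: basis_moment_def distrib_left)

lemma basis_moment_mult_le: "b (n * k) \<le> 2 * b n ^ k"
proof (induction k)
  case 0
  show ?case by (simp add: basis_moment_0)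
next
  case (Suc k)
  have "b (n * Suc k) \<le> b n * b (n * k)" using basis_moment_submult[of n "n * k"] by simp
  also have "\<dots> \<le> b n * (2 * b n ^ k)" by (intro mult_left_mono Suc.IH basis_moment_nonneg)
  finally show ?case by simp
qed

text \<open>A constant factor costs nothing: if \<open>b n < c\<^sup>n\<close> for one \<open>n\<close>, then by submultiplicativity
\<open>b (n k)\<close> is exponentially smaller than \<open>c\<^sup>n\<^sup>k\<close>.\<close>

lemma growth_at_leastI:
  assumes c: "0 < c" and K: "0 < K" and le: "\<And>n. K * c ^ n \<le> b n"
  shows "growth_at_least N r c"
  unfolding growth_at_least_def
proof (intro allI, rule ccontr)
  fix n assume "\<not> c ^ n \<le> b n"
  then have x: "0 \<le> b n / c ^ n" "b n / c ^ n < 1"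
    using c basis_moment_nonneg by (auto simp: field_simps)
  have "(\<lambda>k. 2 * (b n / c ^ n) ^ k) \<longlonglongrightarrow> 2 * 0"
    by (intro tendsto_intros LIMSEQ_power_zero) (use x in auto)
  moreover have "K \<le> 2 * (b n / c ^ n) ^ k" for k
  proof -
    have "K * c ^ (n * k) \<le> 2 * b n ^ k" using le[of "n * k"] basis_moment_mult_le[of n k] by linarith
    then have "K \<le> 2 * b n ^ k / c ^ (n * k)" using c by (simp add: pos_le_divide_eq)
    then show ?thesis by (simp add: power_divide power_mult)
  qed
  ultimately have "K \<le> 2 * 0" by (intro LIMSEQ_le_const[of _ "2 * 0" K]) blast+
  then show False using K by simp
qed

lemma growth_at_least_mono: "growth_at_least N r c \<Longrightarrow> 0 \<le> c' \<Longrightarrow> c' \<le> c \<Longrightarrow> growth_at_least N r c'"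
  unfolding growth_at_least_def by (meson order_trans power_mono)

text \<open>Lower bounds for the growth rate are certified by a function that the transfer operator
expands by at least \<open>c\<close>: its iterates grow at least like \<open>c\<^sup>n\<close> wherever \<open>F\<close> is positive, and
they are dominated by the moments.\<close>

lemma superharmonic_growth:
  assumes c: "0 < c" and F: "continuous_on UNIV F" "\<And>v. F v \<le> C * norm v powr r"
    and super: "\<And>v. c * F v \<le> (\<integral>A. F (A *v v) \<partial>N)" and pos: "0 < F v0"
  shows "growth_at_least N r c"
proof -
  have *: "c ^ n * F v \<le> C * m n v" for n v
  proof (induction n arbitrary: v)
    case 0
    show ?case using F(2) by simp
  next
    case (Suc n)
    have "c ^ Suc n * F v \<le> c ^ n * (\<integral>A. F (A *v v) \<partial>N)"
      using mult_left_mono[OF super[of v], of "c ^ n"] c by (simp add: mult_ac)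
    also have "\<dots> = (\<integral>A. c ^ n * F (A *v v) \<partial>N)" by simp
    also have "\<dots> \<le> (\<integral>A. C * m n (A *v v) \<partial>N)"
      using F(1) Suc.IH
      by (intro integral_mono_op_ball continuous_on_mult_left moment_orbit_continuous
            continuous_orbit) auto
    also have "\<dots> = C * m (Suc n) v" by simp
    finally show ?case .
  qed
  have Cp: "0 < C * norm v0 powr r" using F(2)[of v0] pos by linarith
  then have C: "0 < C" by (simp add: zero_less_mult_iff)
  have "(F v0 / (C * norm v0 powr r)) * c ^ n \<le> b n" for n
  proof -
    have "c ^ n * F v0 \<le> C * (norm v0 powr r * b n)"
      using *[of n v0] mult_left_mono[OF moment_le_basis[of n v0], of C] C by linarith
    then show ?thesis using Cp by (simp add: pos_divide_le_eq mult_ac)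
  qed
  then show ?thesis using c pos Cp by (intro growth_at_leastI[of c "F v0 / (C * norm v0 powr r)"]) auto
qed

text \<open>Dually, a function that dominates a positive multiple of \<open>\<bar>v\<bar>\<^sup>r\<close> and is expanded by at
most \<open>q\<close> caps the growth rate.\<close>

lemma subharmonic_growth:
  assumes q: "0 \<le> q" and C: "0 < C" and F: "continuous_on UNIV F" "\<And>v. C * norm v powr r \<le> F v"
    and sub: "\<And>v. (\<integral>A. F (A *v v) \<partial>N) \<le> q * F v"
    and growth: "growth_at_least N r c" "0 < c"
  shows "c \<le> q"
proof (rule ccontr)
  assume "\<not> c \<le> q"
  have *: "C * m n v \<le> q ^ n * F v" for n v
  proof (induction n arbitrary: v)
    case 0
    show ?case using F(2) by simp
  next
    case (Suc n)
    have "C * m (Suc n) v = (\<integral>A. C * m n (A *v v) \<partial>N)" by simp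
    also have "\<dots> \<le> (\<integral>A. q ^ n * F (A *v v) \<partial>N)"
      using F(1) Suc.IH
      by (intro integral_mono_op_ball continuous_on_mult_left moment_orbit_continuous
            continuous_orbit) auto
    also have "\<dots> = q ^ n * (\<integral>A. F (A *v v) \<partial>N)" by simp
    also have "\<dots> \<le> q ^ n * (q * F v)" by (intro mult_left_mono sub) (use q in auto)
    finally show ?case by (simp add: mult_ac)
  qed
  have "C \<le> (F e1 + F e2) * (q / c) ^ n" for n
  proof -
    have "C * b n \<le> q ^ n * (F e1 + F e2)"
      using *[of n e1] *[of n e2] by (simp add: basis_moment_def distrib_left)
    moreover have "C * c ^ n \<le> C * b n"
      using growth C by (simp add: growth_at_least_def)
    ultimately have "C * c ^ n \<le> q ^ n * (F e1 + F e2)" by linarith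
    then have "C \<le> q ^ n * (F e1 + F e2) / c ^ n"
      using growth(2) by (simp add: pos_le_divide_eq)
    then show ?thesis by (simp add: power_divide mult_ac)
  qed
  moreover have "(\<lambda>n. (F e1 + F e2) * (q / c) ^ n) \<longlonglongrightarrow> (F e1 + F e2) * 0"
    using \<open>\<not> c \<le> q\<close> q growth(2) by (intro tendsto_intros LIMSEQ_power_zero) auto
  ultimately have "C \<le> (F e1 + F e2) * 0" using LIMSEQ_le_const[of _ "(F e1 + F e2) * 0" C] by blast
  then show False using C by simp
qed

text \<open>By Cramer's rule \<open>(v \<and> w) x\<close> is a combination of \<open>v\<close> and \<open>w\<close> with coefficients of size at
most \<open>1\<close> for a unit vector \<open>x\<close>; subadditivity and homogeneity of the moments bound the moment at
\<open>x\<close> by those at \<open>v\<close> and \<open>w\<close>. So the moments cannot be small at two independent vectors.\<close>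

lemma wedge_powr_basis_moment_le:
  assumes "norm v \<le> 1" "norm w \<le> 1"
  shows "\<bar>wedge v w\<bar> powr r * b n \<le> 2 * (m n v + m n w)"
proof -
  have "\<bar>wedge v w\<bar> powr r * m n x \<le> m n v + m n w" if x: "norm x = 1" for x
  proof -
    have "\<bar>wedge x w\<bar> \<le> 1" "\<bar>wedge v x\<bar> \<le> 1"
      using abs_wedge_le[of x w] abs_wedge_le[of v x] assms x by auto
    then have le1: "\<bar>wedge x w\<bar> powr r \<le> 1" "\<bar>wedge v x\<bar> powr r \<le> 1"
      using r_pos by (auto intro!: powr_le1)
    have "\<bar>wedge v w\<bar> powr r * m n x = m n (wedge v w *\<^sub>R x)"
      by (simp add: moment_scaleR)
    also have "\<dots> = m n (wedge x w *\<^sub>R v + wedge v x *\<^sub>R w)"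
      by (rule arg_cong[OF wedge_scaleR_decomposition])
    also have "\<dots> \<le> m n (wedge x w *\<^sub>R v) + m n (wedge v x *\<^sub>R w)"
      by (rule moment_add_le)
    also have "\<dots> = \<bar>wedge x w\<bar> powr r * m n v + \<bar>wedge v x\<bar> powr r * m n w"
      by (simp add: moment_scaleR)
    also have "\<dots> \<le> 1 * m n v + 1 * m n w"
      by (intro add_mono mult_right_mono le1 moment_nonneg)
    finally show ?thesis by simp
  qed
  from this[of e1] this[of e2] show ?thesis
    by (simp add: basis_moment_def distrib_left)
qed

text \<open>The previous bound with \<open>w = A v\<close>, averaged over \<open>A\<close>, shows that the \<open>n\<close>-th moment is at
least \<open>\<kappa>/4 b n\<close> at every unit vector; iterating the transfer operator \<open>k\<close> times on this bound
gives the claim. The hypothesis has \<open>\<bar>v \<and> A v\<bar>\<close> to the power \<open>1\<close>, which is at most its power \<open>r\<close>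
because \<open>\<bar>v \<and> A v\<bar> \<le> 1\<close>; this makes \<open>\<kappa>\<close> independent of \<open>r\<close>.\<close>

lemma supermultiplicative_if_spread:
  assumes k: "0 \<le> \<kappa>" and spread: "\<And>v. norm v = 1 \<Longrightarrow> \<kappa> \<le> (\<integral>A. \<bar>wedge v (A *v v)\<bar> \<partial>N)"
  shows "\<kappa> * b n * b k \<le> 4 * b (n + k)"
proof -
  have unit: "\<kappa> * b n \<le> 4 * m n v" if v: "norm v = 1" for v
  proof -
    have cw: "continuous_on UNIV (\<lambda>A::mat2. \<bar>wedge v (A *v v)\<bar>)" by (intro continuous_intros)
    have "\<kappa> * b n \<le> (\<integral>A. \<bar>wedge v (A *v v)\<bar> \<partial>N) * b n"
      by (intro mult_right_mono spread v basis_moment_nonneg)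
    also have "\<dots> = (\<integral>A. \<bar>wedge v (A *v v)\<bar> * b n \<partial>N)" by simp
    also have "\<dots> \<le> (\<integral>A. 2 * (m n v + m n (A *v v)) \<partial>N)"
    proof (intro integral_mono_op_ball continuous_intros cw moment_orbit_continuous)
      fix A assume A: "A \<in> op_ball"
      then have n: "norm (A *v v) \<le> 1" using op_ball_iff v by metis
      have "\<bar>wedge v (A *v v)\<bar> \<le> 1" using abs_wedge_le[of v "A *v v"] n v by simp
      then have "\<bar>wedge v (A *v v)\<bar> \<le> \<bar>wedge v (A *v v)\<bar> powr r"
        using powr_mono'[of r 1 "\<bar>wedge v (A *v v)\<bar>"] r_le_1 by simp
      then show "\<bar>wedge v (A *v v)\<bar> * b n \<le> 2 * (m n v + m n (A *v v))"
        using wedge_powr_basis_moment_le[of v "A *v v" n] n v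
          mult_right_mono[OF _ basis_moment_nonneg[of n]] by fastforce
    qed
    also have "\<dots> = 2 * (measure N (space N) * m n v + m (Suc n) v)"
      by (simp add: integrable_continuous moment_orbit_continuous)
    also have "\<dots> \<le> 2 * (1 * m n v + m n v)"
      by (intro mult_left_mono add_mono mult_right_mono mass_le_1 moment_nonneg moment_Suc_le) simp
    finally show ?thesis by simp
  qed
  have all: "\<kappa> * b n * norm v powr r \<le> 4 * m n v" for v
  proof (cases "v = 0")
    case True
    then show ?thesis using moment_nonneg[of n 0] r_pos by simp
  next
    case False
    define u where "u = (1 / norm v) *\<^sub>R v"
    have u: "norm u = 1" "v = norm v *\<^sub>R u" using False by (auto simp: u_def)
    have "m n v = norm v powr r * m n u" using moment_scaleR[of n "norm v" u] u(2) by simp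
    moreover have "norm v powr r * (\<kappa> * b n) \<le> norm v powr r * (4 * m n u)"
      by (intro mult_left_mono unit u) simp
    ultimately show ?thesis by (simp add: mult_ac)
  qed
  have "\<kappa> * b n * m k v \<le> 4 * m (n + k) v" for v
  proof (induction k arbitrary: v)
    case 0
    show ?case using all by simp
  next
    case (Suc k)
    have "\<kappa> * b n * m (Suc k) v = (\<integral>A. \<kappa> * b n * m k (A *v v) \<partial>N)" by simp
    also have "\<dots> \<le> (\<integral>A. 4 * m (n + k) (A *v v) \<partial>N)"
      by (intro integral_mono_op_ball continuous_on_mult_left moment_orbit_continuous Suc.IH)
    finally show ?case by simp
  qed
  from this[of e1] this[of e2] show ?thesis
    by (simp add: basis_moment_def distrib_left)
qed

end

section \<open>Frames adapted to an invariant line\<close>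

definition perp :: "real^2 \<Rightarrow> real^2" where
  "perp u = vector [- (u$2), u$1]"

lemma perp_simps [simp]: "perp u $ 1 = - (u$2)" "perp u $ 2 = u$1"
  by (simp_all add: perp_def)

lemma frame_decomposition:
  assumes "norm u = 1"
  shows "x = (u \<bullet> x) *\<^sub>R u + wedge u x *\<^sub>R perp u"
proof -
  have *: "u$1 * u$1 + u$2 * u$2 = 1" using norm_sq_2[of u] assms by (simp add: power2_eq_square)
  have "x$1 = (u$1 * u$1 + u$2 * u$2) * x$1" "x$2 = (u$1 * u$1 + u$2 * u$2) * x$2"
    unfolding * by auto
  then show ?thesis
    by (simp add: vec_eq_iff forall_2 wedge_def inner_2 algebra_simps)
qed

lemma norm_perp [simp]: "norm (perp u) = norm u"
proof -
  have "(norm (perp u))\<^sup>2 = (norm u)\<^sup>2" by (simp add: norm_sq_2)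
  then show ?thesis by simp
qed

text \<open>The numbers \<open>u \<bullet> A u\<close>, \<open>u \<bullet> A u\<^sup>\<bottom>\<close>, \<open>u \<and> A u\<close> and \<open>u \<and> A u\<^sup>\<bottom>\<close> are the entries of \<open>A\<close> in
the frame \<open>(u, u\<^sup>\<bottom>)\<close>. The line through \<open>u\<close> is invariant if the lower left entry \<open>u \<and> A u\<close>
vanishes.\<close>

lemma frame_image:
  assumes "norm u = 1"
  shows "u \<bullet> (A *v v) = (u \<bullet> v) * (u \<bullet> (A *v u)) + wedge u v * (u \<bullet> (A *v perp u))"
    and "wedge u (A *v v) = (u \<bullet> v) * wedge u (A *v u) + wedge u v * wedge u (A *v perp u)"
proof -
  have "A *v v = A *v ((u \<bullet> v) *\<^sub>R u + wedge u v *\<^sub>R perp u)"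
    using frame_decomposition[OF assms, of v] by simp
  also have "\<dots> = (u \<bullet> v) *\<^sub>R (A *v u) + wedge u v *\<^sub>R (A *v perp u)"
    by (simp add: matrix_vector_right_distrib matrix_vector_mult_scaleR)
  finally have *: "A *v v = (u \<bullet> v) *\<^sub>R (A *v u) + wedge u v *\<^sub>R (A *v perp u)" .
  show "u \<bullet> (A *v v) = (u \<bullet> v) * (u \<bullet> (A *v u)) + wedge u v * (u \<bullet> (A *v perp u))"
    by (subst *) (simp add: inner_add_right)
  show "wedge u (A *v v) = (u \<bullet> v) * wedge u (A *v u) + wedge u v * wedge u (A *v perp u)"
    by (subst *) (simp add: wedge_def algebra_simps)
qed

context contractive_moments
begin

text \<open>The certificate is \<open>F(v) = max 0 (p\<bar>x\<^sub>1\<bar>\<^sup>r + q\<bar>x\<^sub>2\<bar>\<^sup>r)\<close> in the coordinates \<open>x\<^sub>1\<close>, \<open>x\<^sub>2\<close> of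
the frame. Since \<open>r \<le> 1\<close>, both signs of a coefficient \<open>p\<close> admit the estimate
\<open>p\<bar>x + y\<bar>\<^sup>r \<ge> p\<bar>x\<bar>\<^sup>r - \<bar>p\<bar>\<bar>y\<bar>\<^sup>r\<close>, which separates the entries of \<open>A\<close> from the coordinates of
\<open>v\<close>. Only four scalar moments of the entries remain, and these depend continuously on the
measure.\<close>

lemma frame_superharmonic_growth:
  assumes u: "norm u = 1" and c: "0 < c" and pq: "0 < p \<or> 0 < q"
    and p: "c * p \<le> p * (\<integral>A. \<bar>u \<bullet> (A *v u)\<bar> powr r \<partial>N) - \<bar>q\<bar> * (\<integral>A. \<bar>wedge u (A *v u)\<bar> powr r \<partial>N)"
    and q: "c * q \<le> q * (\<integral>A. \<bar>wedge u (A *v perp u)\<bar> powr r \<partial>N) - \<bar>p\<bar> * (\<integral>A. \<bar>u \<bullet> (A *v perp u)\<bar> powr r \<partial>N)"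
  shows "growth_at_least N r c"
proof -
  define G where "G v = p * \<bar>u \<bullet> v\<bar> powr r + q * \<bar>wedge u v\<bar> powr r" for v
  define F where "F v = max 0 (G v)" for v
  have contG: "continuous_on UNIV G"
    unfolding G_def using r_pos
    by (intro continuous_on_add continuous_on_mult_left continuous_abs_powr continuous_intros) auto
  then have cont: "continuous_on UNIV F" unfolding F_def by (intro continuous_intros)
  have dom: "F v \<le> (\<bar>p\<bar> + \<bar>q\<bar>) * norm v powr r" for v
  proof -
    have "\<bar>u \<bullet> v\<bar> powr r \<le> norm v powr r" "\<bar>wedge u v\<bar> powr r \<le> norm v powr r"
      using Cauchy_Schwarz_ineq2[of u v] abs_wedge_le[of u v] u r_pos by (auto intro!: powr_mono2)
    then have "p * \<bar>u \<bullet> v\<bar> powr r \<le> \<bar>p\<bar> * norm v powr r" "q * \<bar>wedge u v\<bar> powr r \<le> \<bar>q\<bar> * norm v powr r"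
      by (intro mult_mono; simp)+
    then show ?thesis by (auto simp: F_def G_def distrib_right)
  qed
  have super: "c * F v \<le> (\<integral>A. F (A *v v) \<partial>N)" for v
  proof -
    define X where "X = \<bar>u \<bullet> v\<bar> powr r"
    define Y where "Y = \<bar>wedge u v\<bar> powr r"
    define H where "H A = (p * \<bar>u \<bullet> (A *v u)\<bar> powr r - \<bar>q\<bar> * \<bar>wedge u (A *v u)\<bar> powr r) * X
      + (q * \<bar>wedge u (A *v perp u)\<bar> powr r - \<bar>p\<bar> * \<bar>u \<bullet> (A *v perp u)\<bar> powr r) * Y" for A
    have ce: "continuous_on UNIV (\<lambda>A::mat2. \<bar>u \<bullet> (A *v x)\<bar> powr r)"
      "continuous_on UNIV (\<lambda>A::mat2. \<bar>wedge u (A *v x)\<bar> powr r)" for x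
      using r_pos by (intro continuous_abs_powr continuous_intros; simp)+
    have contH: "continuous_on UNIV H"
      unfolding H_def by (intro continuous_intros ce)
    have HG: "H A \<le> G (A *v v)" for A
      using scaled_powr_add_ge[OF r_pos r_le_1, of p "(u \<bullet> v) * (u \<bullet> (A *v u))" "wedge u v * (u \<bullet> (A *v perp u))"]
        scaled_powr_add_ge[OF r_pos r_le_1, of q "wedge u v * wedge u (A *v perp u)" "(u \<bullet> v) * wedge u (A *v u)"]
      unfolding G_def H_def X_def Y_def frame_image[OF u, of A v]
      by (simp add: abs_mult powr_mult algebra_simps)
    have "c * G v = (c * p) * X + (c * q) * Y"
      by (simp add: G_def X_def Y_def algebra_simps)
    also have "\<dots> \<le> (p * (\<integral>A. \<bar>u \<bullet> (A *v u)\<bar> powr r \<partial>N) - \<bar>q\<bar> * (\<integral>A. \<bar>wedge u (A *v u)\<bar> powr r \<partial>N)) * X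
       + (q * (\<integral>A. \<bar>wedge u (A *v perp u)\<bar> powr r \<partial>N) - \<bar>p\<bar> * (\<integral>A. \<bar>u \<bullet> (A *v perp u)\<bar> powr r \<partial>N)) * Y"
      by (intro add_mono mult_right_mono p q) (auto simp: X_def Y_def)
    also have "\<dots> = integral\<^sup>L N H"
      unfolding H_def by (simp add: integrable_continuous ce)
    also have "\<dots> \<le> (\<integral>A. F (A *v v) \<partial>N)"
      using HG by (intro integral_mono_op_ball contH continuous_orbit cont) (auto simp: F_def intro: order_trans max.coboundedI2)
    finally have 1: "c * G v \<le> (\<integral>A. F (A *v v) \<partial>N)" .
    have 2: "0 \<le> (\<integral>A. F (A *v v) \<partial>N)"
      by (intro Bochner_Integration.integral_nonneg) (simp add: F_def)
    show ?thesis
      using 1 2 c by (auto simp: F_def max_def)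
  qed
  have uu: "u \<bullet> u = 1" "wedge u u = 0" "u \<bullet> perp u = 0" "wedge u (perp u) = 1"
    using u norm_sq_2[of u] by (auto simp: inner_2 wedge_def power2_eq_square)
  from pq show ?thesis
  proof
    assume "0 < p"
    then have "0 < F u" using r_pos by (simp add: F_def G_def uu)
    then show ?thesis by (rule superharmonic_growth[OF c cont dom super])
  next
    assume "0 < q"
    then have "0 < F (perp u)" using r_pos by (simp add: F_def G_def uu)
    then show ?thesis by (rule superharmonic_growth[OF c cont dom super])
  qed
qed

text \<open>For triangular matrices the off-diagonal entry can be made as unimportant as desired by
rescaling the first coordinate: \<open>\<epsilon>\<bar>x\<^sub>1\<bar>\<^sup>r + \<bar>x\<^sub>2\<bar>\<^sup>r\<close> is expanded at most by \<open>max \<alpha> (\<delta> + \<epsilon>\<beta>)\<close>.\<close>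

lemma triangular_growth_le:
  assumes u: "norm u = 1" and inv: "(\<integral>A. \<bar>wedge u (A *v u)\<bar> \<partial>N) = 0"
    and growth: "growth_at_least N r c" "0 < c"
  shows "c \<le> max (\<integral>A. \<bar>u \<bullet> (A *v u)\<bar> powr r \<partial>N) (\<integral>A. \<bar>wedge u (A *v perp u)\<bar> powr r \<partial>N)"
proof (rule ccontr)
  define \<alpha> where "\<alpha> = (\<integral>A. \<bar>u \<bullet> (A *v u)\<bar> powr r \<partial>N)"
  define \<beta> where "\<beta> = (\<integral>A. \<bar>u \<bullet> (A *v perp u)\<bar> powr r \<partial>N)"
  define \<delta> where "\<delta> = (\<integral>A. \<bar>wedge u (A *v perp u)\<bar> powr r \<partial>N)"
  assume "\<not> ?thesis"
  then have "max \<alpha> \<delta> < c" unfolding \<alpha>_def \<delta>_def by (simp add: le_max_iff_disj not_le)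
  then obtain q where q: "\<alpha> < q" "\<delta> < q" "q < c" using dense by (metis max_less_iff_conj)
  have nn: "0 \<le> \<alpha>" "0 \<le> \<beta>" "0 \<le> \<delta>" by (simp_all add: \<alpha>_def \<beta>_def \<delta>_def)
  define \<epsilon> where "\<epsilon> = (q - \<delta>) / (\<beta> + 1)"
  have e: "0 < \<epsilon>" using q nn by (simp add: \<epsilon>_def)
  have "\<epsilon> * (\<beta> + 1) = q - \<delta>" using nn by (simp add: \<epsilon>_def)
  then have eb: "\<epsilon> * \<beta> + \<delta> \<le> q" using e by (simp add: algebra_simps)
  define F where "F v = \<epsilon> * \<bar>u \<bullet> v\<bar> powr r + \<bar>wedge u v\<bar> powr r" for v
  have cont: "continuous_on UNIV F"
    unfolding F_def using r_pos
    by (intro continuous_on_add continuous_on_mult_left continuous_abs_powr continuous_intros) auto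
  have ce: "continuous_on UNIV (\<lambda>A::mat2. \<bar>u \<bullet> (A *v x)\<bar> powr r)"
    "continuous_on UNIV (\<lambda>A::mat2. \<bar>wedge u (A *v x)\<bar> powr r)" for x
    using r_pos by (intro continuous_abs_powr continuous_intros; simp)+
  have AE0: "AE A in N. wedge u (A *v u) = 0"
    using inv integral_nonneg_eq_0_iff_AE[of N "\<lambda>A. \<bar>wedge u (A *v u)\<bar>"]
    by (simp add: integrable_continuous continuous_intros)
  have "(\<integral>A. F (A *v v) \<partial>N) \<le> q * F v" for v
  proof -
    define X where "X = \<bar>u \<bullet> v\<bar> powr r"
    define Y where "Y = \<bar>wedge u v\<bar> powr r"
    define H where "H A = \<epsilon> * (\<bar>u \<bullet> (A *v u)\<bar> powr r * X + \<bar>u \<bullet> (A *v perp u)\<bar> powr r * Y)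
      + \<bar>wedge u (A *v perp u)\<bar> powr r * Y" for A
    have contH: "continuous_on UNIV H"
      unfolding H_def by (intro continuous_intros ce)
    have "AE A in N. F (A *v v) \<le> H A"
      using AE0
    proof eventually_elim
      case (elim A)
      have "\<epsilon> * \<bar>u \<bullet> (A *v v)\<bar> powr r \<le> \<epsilon> * (\<bar>u \<bullet> (A *v u)\<bar> powr r * X + \<bar>u \<bullet> (A *v perp u)\<bar> powr r * Y)"
        using powr_abs_add_le[OF r_pos r_le_1, of "(u \<bullet> v) * (u \<bullet> (A *v u))" "wedge u v * (u \<bullet> (A *v perp u))"] e
        unfolding frame_image(1)[OF u, of A v] X_def Y_def
        by (intro mult_left_mono) (auto simp: abs_mult powr_mult mult_ac)
      moreover have "\<bar>wedge u (A *v v)\<bar> powr r = \<bar>wedge u (A *v perp u)\<bar> powr r * Y"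
        unfolding frame_image(2)[OF u, of A v] elim Y_def by (simp add: abs_mult powr_mult mult_ac)
      ultimately show ?case by (simp add: F_def H_def)
    qed
    then have "(\<integral>A. F (A *v v) \<partial>N) \<le> integral\<^sup>L N H"
      by (intro integral_mono_AE integrable_continuous contH continuous_orbit cont)
    also have "\<dots> = \<epsilon> * (\<alpha> * X + \<beta> * Y) + \<delta> * Y"
      unfolding H_def \<alpha>_def \<beta>_def \<delta>_def by (simp add: integrable_continuous ce)
    also have "\<dots> = (\<epsilon> * \<alpha>) * X + (\<epsilon> * \<beta> + \<delta>) * Y" by (simp add: algebra_simps)
    also have "\<dots> \<le> (\<epsilon> * q) * X + q * Y"
      using q e by (intro add_mono mult_right_mono mult_left_mono eb) (auto simp: X_def Y_def)
    finally show ?thesis by (simp add: F_def X_def Y_def algebra_simps)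
  qed
  moreover have "min \<epsilon> 1 * norm v powr r \<le> F v" for v
  proof -
    have "norm v \<le> norm ((u \<bullet> v) *\<^sub>R u) + norm (wedge u v *\<^sub>R perp u)"
      using frame_decomposition[OF u, of v] norm_triangle_ineq by metis
    then have "norm v \<le> \<bar>u \<bullet> v\<bar> + \<bar>wedge u v\<bar>" using u by simp
    then have "norm v powr r \<le> (\<bar>u \<bullet> v\<bar> + \<bar>wedge u v\<bar>) powr r"
      using r_pos by (intro powr_mono2) auto
    also have "\<dots> \<le> \<bar>u \<bullet> v\<bar> powr r + \<bar>wedge u v\<bar> powr r"
      using r_pos r_le_1 by (intro powr_add_le) auto
    finally have "min \<epsilon> 1 * norm v powr r \<le> min \<epsilon> 1 * \<bar>u \<bullet> v\<bar> powr r + min \<epsilon> 1 * \<bar>wedge u v\<bar> powr r"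
      using e by (simp add: distrib_left[symmetric] mult_left_mono)
    also have "\<dots> \<le> F v"
      using mult_right_mono[of "min \<epsilon> 1" \<epsilon> "\<bar>u \<bullet> v\<bar> powr r"]
        mult_right_mono[of "min \<epsilon> 1" 1 "\<bar>wedge u v\<bar> powr r"] by (simp add: F_def)
    finally show ?thesis .
  qed
  ultimately have "c \<le> q"
    using q nn e by (intro subharmonic_growth[of q "min \<epsilon> 1" F c] growth cont) auto
  then show False using q by simp
qed

lemma spread_Lipschitz:
  assumes "norm v = 1" "norm w = 1"
  shows "\<bar>(\<integral>A. \<bar>wedge v (A *v v)\<bar> \<partial>N) - (\<integral>A. \<bar>wedge w (A *v w)\<bar> \<partial>N)\<bar> \<le> 2 * norm (v - w)"
proof -
  have *: "(\<integral>A. \<bar>wedge v (A *v v)\<bar> \<partial>N) - (\<integral>A. \<bar>wedge w (A *v w)\<bar> \<partial>N) \<le> 2 * norm (v - w)"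
    if vw: "norm v = 1" "norm w = 1" for v w
  proof -
    have c: "continuous_on UNIV (\<lambda>A::mat2. \<bar>wedge v (A *v v)\<bar>)" for v by (intro continuous_intros)
    have "(\<integral>A. \<bar>wedge v (A *v v)\<bar> \<partial>N) - (\<integral>A. \<bar>wedge w (A *v w)\<bar> \<partial>N)
        = (\<integral>A. \<bar>wedge v (A *v v)\<bar> - \<bar>wedge w (A *v w)\<bar> \<partial>N)"
      by (simp add: integrable_continuous c)
    also have "\<dots> \<le> 2 * norm (v - w)"
    proof (intro integral_le_const continuous_on_diff c)
      fix A assume A: "A \<in> op_ball"
      have "wedge v (A *v v) - wedge w (A *v w) = wedge (v - w) (A *v v) + wedge w (A *v (v - w))"
        by (simp add: wedge_def mult_vec_2 algebra_simps)
      then have "\<bar>wedge v (A *v v)\<bar> - \<bar>wedge w (A *v w)\<bar> \<le> \<bar>wedge (v - w) (A *v v)\<bar> + \<bar>wedge w (A *v (v - w))\<bar>"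
        by linarith
      also have "\<dots> \<le> norm (v - w) * norm (A *v v) + norm w * norm (A *v (v - w))"
        by (intro add_mono abs_wedge_le)
      also have "\<dots> \<le> norm (v - w) * norm v + norm w * norm (v - w)"
        using A op_ball_iff by (intro add_mono mult_left_mono) auto
      finally show "\<bar>wedge v (A *v v)\<bar> - \<bar>wedge w (A *v w)\<bar> \<le> 2 * norm (v - w)"
        using vw by simp
    qed simp
    finally show ?thesis .
  qed
  show ?thesis
    using *[OF assms] *[OF assms(2,1)] by (simp add: abs_le_iff norm_minus_commute)
qed

end

section \<open>Semicontinuity of the growth rate\<close>

definition weakly_convergent :: "('i \<Rightarrow> mat2 measure) \<Rightarrow> mat2 measure \<Rightarrow> 'i filter \<Rightarrow> bool" where
  "weakly_convergent N M F \<longleftrightarrow>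
     (\<forall>h::mat2 \<Rightarrow> real. continuous_on UNIV h \<longrightarrow> ((\<lambda>i. integral\<^sup>L (N i) h) \<longlongrightarrow> integral\<^sup>L M h) F)"

text \<open>Weak convergence and uniform convergence of the integrands on the ball combine, because
the masses are bounded by \<open>1\<close>.\<close>

lemma integral_tendsto_uniform_limit:
  fixes h :: "'i \<Rightarrow> mat2 \<Rightarrow> real"
  assumes con: "\<forall>\<^sub>F i in F. contractive_measure (N i)"
    and wc: "weakly_convergent N M F"
    and unif: "uniform_limit op_ball h l F"
    and hc: "\<forall>\<^sub>F i in F. continuous_on UNIV (h i)" and lc: "continuous_on UNIV l"
  shows "((\<lambda>i. integral\<^sup>L (N i) (h i)) \<longlongrightarrow> integral\<^sup>L M l) F"
proof (rule tendstoI)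
  fix e :: real assume e: "0 < e"
  have "\<forall>\<^sub>F i in F. dist (integral\<^sup>L (N i) l) (integral\<^sup>L M l) < e / 2"
    using wc lc e by (auto simp: weakly_convergent_def dest!: tendstoD[where e = "e / 2"])
  moreover have "\<forall>\<^sub>F i in F. \<forall>A\<in>op_ball. dist (h i A) (l A) < e / 2"
    using uniform_limitD[OF unif, of "e / 2"] e by simp
  ultimately show "\<forall>\<^sub>F i in F. dist (integral\<^sup>L (N i) (h i)) (integral\<^sup>L M l) < e"
    using con hc
  proof eventually_elim
    case (elim i)
    interpret contractive_measure "N i" by (rule elim(3))
    have close: "h i A - l A \<le> e / 2" "l A - h i A \<le> e / 2" if "A \<in> op_ball" for A
      using bspec[OF elim(2) that] unfolding dist_real_def by linarith+
    have "(\<integral>A. h i A - l A \<partial>N i) \<le> e / 2" "(\<integral>A. l A - h i A \<partial>N i) \<le> e / 2"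
      using e by (intro integral_le_const continuous_on_diff elim lc close; simp)+
    moreover have "(\<integral>A. h i A - l A \<partial>N i) = integral\<^sup>L (N i) (h i) - integral\<^sup>L (N i) l"
      "(\<integral>A. l A - h i A \<partial>N i) = integral\<^sup>L (N i) l - integral\<^sup>L (N i) (h i)"
      by (intro Bochner_Integration.integral_diff integrable_continuous elim lc)+
    ultimately have "\<bar>integral\<^sup>L (N i) (h i) - integral\<^sup>L (N i) l\<bar> \<le> e / 2"
      by (simp only: abs_le_iff minus_diff_eq)
    then show ?case using elim(1) unfolding dist_real_def by linarith
  qed
qed

lemma abs_powr_uniform_limit:
  fixes e :: "'a \<Rightarrow> real" and p :: "'i \<Rightarrow> real"
  assumes "(p \<longlongrightarrow> q) F" "0 < q" "\<And>x. x \<in> S \<Longrightarrow> \<bar>e x\<bar> \<le> 1"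
  shows "uniform_limit S (\<lambda>i x. \<bar>e x\<bar> powr p i) (\<lambda>x. \<bar>e x\<bar> powr q) F"
proof (rule uniform_limitI)
  fix \<epsilon> :: real assume "0 < \<epsilon>"
  from uniform_limitD[OF uniform_limit_powr_exponent[OF assms(1,2)] this]
  show "\<forall>\<^sub>F i in F. \<forall>x\<in>S. dist (\<bar>e x\<bar> powr p i) (\<bar>e x\<bar> powr q) < \<epsilon>"
    by eventually_elim (use assms(3) in auto)
qed

lemma abs_powr_mult_integral_tendsto:
  fixes e h :: "mat2 \<Rightarrow> real"
  assumes con: "\<forall>\<^sub>F i in F. contractive_measure (N i)" and wc: "weakly_convergent N M F"
    and p: "(p \<longlongrightarrow> q) F" "0 < q"
    and e: "continuous_on UNIV e" "\<And>A. A \<in> op_ball \<Longrightarrow> \<bar>e A\<bar> \<le> 1" and h: "continuous_on UNIV h"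
  shows "((\<lambda>i. \<integral>A. \<bar>e A\<bar> powr p i * h A \<partial>N i) \<longlongrightarrow> (\<integral>A. \<bar>e A\<bar> powr q * h A \<partial>M)) F"
proof (rule integral_tendsto_uniform_limit[OF con wc])
  have bounded: "bounded (g ` op_ball)" if "continuous_on UNIV g" for g :: "mat2 \<Rightarrow> real"
    using compact_imp_bounded[OF compact_continuous_image[OF continuous_on_subset[OF that] compact_op_ball]]
    by simp
  have cont: "continuous_on UNIV (\<lambda>A. \<bar>e A\<bar> powr t)" if "0 < t" for t
    by (rule continuous_abs_powr[OF e(1) that])
  show "uniform_limit op_ball (\<lambda>i A. \<bar>e A\<bar> powr p i * h A) (\<lambda>A. \<bar>e A\<bar> powr q * h A) F"
    using bounded[OF cont[OF p(2)]] bounded[OF h]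
    by (intro uniform_lim_mult abs_powr_uniform_limit p e uniform_limit_const)
  have "\<forall>\<^sub>F i in F. 0 < p i" using p by (rule order_tendstoD)
  then show "\<forall>\<^sub>F i in F. continuous_on UNIV (\<lambda>A. \<bar>e A\<bar> powr p i * h A)"
    by eventually_elim (intro continuous_on_mult cont h)
  show "continuous_on UNIV (\<lambda>A. \<bar>e A\<bar> powr q * h A)"
    using p by (intro continuous_on_mult cont h)
qed

locale converging_measures =
  fixes N :: "'i \<Rightarrow> mat2 measure" and M :: "mat2 measure" and r :: "'i \<Rightarrow> real" and q :: real
    and F :: "'i filter"
  assumes contractive: "\<forall>\<^sub>F i in F. contractive_moments (N i) (r i)"
    and limit_contractive: "contractive_moments M q"
    and weak: "weakly_convergent N M F"
    and exponent: "(r \<longlongrightarrow> q) F"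
begin

interpretation M: contractive_moments M q by (rule limit_contractive)

lemma contractive_measures: "\<forall>\<^sub>F i in F. contractive_measure (N i)"
  using contractive by eventually_elim (simp add: contractive_moments_def)

text \<open>Induction on \<open>n\<close>: uniform convergence on the unit disc gives uniform convergence of the
integrand \<open>A \<mapsto> m n (A v)\<close> on the ball, hence pointwise convergence of the next moment, and this
is uniform because the moments are equicontinuous; the exponents \<open>r i\<close> eventually exceed
\<open>q / 2\<close>.\<close>

lemma moment_uniform_limit:
  "uniform_limit (cball 0 1) (\<lambda>i. moment (N i) (r i) n) (moment M q n) F"
proof (induction n)
  case 0
  show ?case
    using abs_powr_uniform_limit[OF exponent M.r_pos, of "cball 0 1" norm] by (simp add: dist_norm)
next
  case (Suc n)
  show ?case
  proof (rule uniform_limit_equicontinuous)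
    fix e :: real assume e: "0 < e"
    \<comment> \<open>Distances below \<open>1\<close> let the varying exponent \<open>r i > q / 2\<close> be replaced by \<open>q / 2\<close>.\<close>
    define d where "d = min 1 (e powr (2 / q))"
    have "\<forall>\<^sub>F i in F. q / 2 < r i" using order_tendstoD(1)[OF exponent, of "q / 2"] M.r_pos by simp
    then have "\<forall>\<^sub>F i in F. \<forall>v\<in>cball 0 1. \<forall>w\<in>cball 0 1. dist v w < d \<longrightarrow>
        dist (moment (N i) (r i) (Suc n) v) (moment (N i) (r i) (Suc n) w) < e"
      using contractive
    proof (eventually_elim, intro ballI impI)
      fix i and v w :: "real^2" assume i: "q / 2 < r i" "contractive_moments (N i) (r i)" and d: "dist v w < d"
      interpret contractive_moments "N i" "r i" by (rule i)
      have "dist (m (Suc n) v) (m (Suc n) w) \<le> norm (v - w) powr r i"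
        using moment_Holder[of "Suc n" v w] by (simp only: dist_real_def)
      also have "\<dots> \<le> norm (v - w) powr (q / 2)"
        using d i(1) by (intro powr_mono') (auto simp: d_def dist_norm)
      also have "\<dots> < (e powr (2 / q)) powr (q / 2)"
        using d M.r_pos by (intro powr_less_mono2) (auto simp: d_def dist_norm)
      also have "\<dots> = e" using e M.r_pos by (simp add: powr_powr)
      finally show "dist (m (Suc n) v) (m (Suc n) w) < e" .
    qed
    moreover have "d > 0" using e by (simp add: d_def)
    ultimately show "\<exists>d>0. \<forall>\<^sub>F i in F. \<forall>v\<in>cball 0 1. \<forall>w\<in>cball 0 1. dist v w < d \<longrightarrow>
        dist (moment (N i) (r i) (Suc n) v) (moment (N i) (r i) (Suc n) w) < e" by blast
  next
    show "continuous_on (cball 0 1) (moment M q (Suc n))"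
      using M.moment_continuous continuous_on_subset by blast
  next
    fix v :: "real^2" assume v: "v \<in> cball 0 1"
    have "uniform_limit op_ball (\<lambda>i A. moment (N i) (r i) n (A *v v)) (\<lambda>A. moment M q n (A *v v)) F"
    proof (rule uniform_limitI)
      fix e :: real assume "0 < e"
      from uniform_limitD[OF Suc.IH this]
      show "\<forall>\<^sub>F i in F. \<forall>A\<in>op_ball. dist (moment (N i) (r i) n (A *v v)) (moment M q n (A *v v)) < e"
      proof (eventually_elim, intro ballI)
        fix i A assume h: "\<forall>x\<in>cball 0 1. dist (moment (N i) (r i) n x) (moment M q n x) < e" and A: "A \<in> op_ball"
        have "norm (A *v v) \<le> norm v" using A op_ball_iff by blast
        then have "A *v v \<in> cball 0 1" using v by simp
        then show "dist (moment (N i) (r i) n (A *v v)) (moment M q n (A *v v)) < e"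
          using h by blast
      qed
    qed
    moreover have "\<forall>\<^sub>F i in F. continuous_on UNIV (\<lambda>A::mat2. moment (N i) (r i) n (A *v v))"
      using contractive by eventually_elim (rule contractive_moments.moment_orbit_continuous)
    ultimately show "((\<lambda>i. moment (N i) (r i) (Suc n) v) \<longlongrightarrow> moment M q (Suc n) v) F"
      unfolding moment.simps
      by (intro integral_tendsto_uniform_limit contractive_measures weak M.moment_orbit_continuous)
  qed simp
qed

lemma basis_moment_tendsto: "((\<lambda>i. basis_moment (N i) (r i) n) \<longlongrightarrow> basis_moment M q n) F"
  unfolding basis_moment_def
  by (intro tendsto_add tendsto_uniform_limitI[OF moment_uniform_limit]) auto

lemma growth_upper_semicontinuous:
  assumes "\<not> growth_at_least M q c"
  shows "\<forall>\<^sub>F i in F. \<not> growth_at_least (N i) (r i) c"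
proof -
  obtain n where "basis_moment M q n < c ^ n"
    using assms by (auto simp: growth_at_least_def not_le)
  then have "\<forall>\<^sub>F i in F. basis_moment (N i) (r i) n < c ^ n"
    by (rule order_tendstoD(2)[OF basis_moment_tendsto])
  then show ?thesis
    by eventually_elim (auto simp: growth_at_least_def not_le)
qed

text \<open>The spread \<open>\<integral> \<bar>v \<and> A v\<bar> dM(A)\<close> is continuous and positive on the unit circle, so it has a
positive minimum \<open>2\<kappa>\<close>, and the spread of \<open>N i\<close> is eventually at least \<open>\<kappa>\<close>. Choose \<open>n\<close> so large
that the factor \<open>\<kappa>/4\<close> is negligible against \<open>(c'/c)\<^sup>n\<close>; then the \<open>n\<close>-th moment alone, which
converges, already certifies the rate \<open>c\<close> for \<open>N i\<close>.\<close>

lemma growth_lower_semicontinuous_irreducible: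
  assumes irr: "\<And>u. norm u = 1 \<Longrightarrow> (\<integral>A. \<bar>wedge u (A *v u)\<bar> \<partial>M) \<noteq> 0"
    and growth: "growth_at_least M q c'" and c: "0 < c" "c < c'"
  shows "\<forall>\<^sub>F i in F. growth_at_least (N i) (r i) c"
proof -
  define s where "s K v = (\<integral>A. \<bar>wedge v (A *v v)\<bar> \<partial>K)" for K :: "mat2 measure" and v
  have Lip: "dist (s K v) (s K w) \<le> 2 * dist v w" if "contractive_moments K p" "v \<in> sphere 0 1" "w \<in> sphere 0 1" for K p v w
    using contractive_moments.spread_Lipschitz[OF that(1), of v w] that by (simp add: s_def dist_norm)
  have Lc: "continuous_on (sphere 0 1) (s M)"
    unfolding continuous_on_iff
  proof (intro ballI allI impI)
    fix v :: "real^2" and e :: real assume "v \<in> sphere 0 1" "0 < e"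
    then show "\<exists>d>0. \<forall>w\<in>sphere 0 1. dist w v < d \<longrightarrow> dist (s M w) (s M v) < e"
      using Lip[OF limit_contractive] by (intro exI[of _ "e / 2"]) fastforce
  qed
  have ne: "sphere (0::real^2) 1 \<noteq> {}" using norm_axis_1 by (metis mem_sphere_0 empty_iff)
  obtain v0 where v0: "v0 \<in> sphere 0 1" "\<And>v. v \<in> sphere 0 1 \<Longrightarrow> s M v0 \<le> s M v"
    using continuous_attains_inf[OF compact_sphere ne Lc] by blast
  define \<kappa> where "\<kappa> = s M v0 / 2"
  have k: "\<kappa> > 0"
  proof -
    have "s M v0 \<ge> 0" by (simp add: s_def)
    moreover have "s M v0 \<noteq> 0" using irr v0 by (simp add: s_def)
    ultimately show ?thesis by (simp add: \<kappa>_def)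
  qed
  have unif: "uniform_limit (sphere 0 1) (\<lambda>i. s (N i)) (s M) F"
  proof (rule uniform_limit_equicontinuous[OF _ _ Lc])
    fix e :: real assume e: "0 < e"
    have "\<forall>\<^sub>F i in F. \<forall>v\<in>sphere 0 1. \<forall>w\<in>sphere 0 1. dist v w < e / 2 \<longrightarrow> dist (s (N i) v) (s (N i) w) < e"
      using contractive by eventually_elim (use Lip in fastforce)
    then show "\<exists>d>0. \<forall>\<^sub>F i in F. \<forall>v\<in>sphere 0 1. \<forall>w\<in>sphere 0 1. dist v w < d \<longrightarrow> dist (s (N i) v) (s (N i) w) < e"
      using e half_gt_zero by blast
  next
    fix v :: "real^2"
    have "continuous_on UNIV (\<lambda>A::mat2. \<bar>wedge v (A *v v)\<bar>)" by (intro continuous_intros)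
    then show "((\<lambda>i. s (N i) v) \<longlongrightarrow> s M v) F"
      using weak by (simp add: s_def weakly_convergent_def)
  qed simp
  from uniform_limitD[OF unif k]
  have spread: "\<forall>\<^sub>F i in F. \<forall>v\<in>sphere 0 1. \<kappa> \<le> s (N i) v"
  proof eventually_elim
    case (elim i)
    show ?case
    proof
      fix v :: "real^2" assume v: "v \<in> sphere 0 1"
      have "dist (s (N i) v) (s M v) < \<kappa>" "2 * \<kappa> \<le> s M v"
        using elim v0(2)[OF v] v by (auto simp: \<kappa>_def)
      then show "\<kappa> \<le> s (N i) v" unfolding dist_real_def by linarith
    qed
  qed
  \<comment> \<open>Positivity of \<open>n\<close> is needed to extract an \<open>n\<close>-th root at the end.\<close>
  obtain n0 where n0: "4 / \<kappa> < (c' / c) ^ n0" using real_arch_pow[of "c' / c"] c by auto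
  define n where "n = Suc n0"
  have n: "4 / \<kappa> < (c' / c) ^ n" "0 < n"
    using n0 power_increasing[of n0 n "c' / c"] c by (auto simp: n_def)
  have "4 / \<kappa> * c ^ n < c' ^ n"
    using n(1) c by (simp add: power_divide pos_less_divide_eq)
  also have "\<dots> \<le> basis_moment M q n" using growth by (simp add: growth_at_least_def)
  finally have "\<forall>\<^sub>F i in F. 4 / \<kappa> * c ^ n < basis_moment (N i) (r i) n"
    by (rule order_tendstoD(1)[OF basis_moment_tendsto])
  with spread contractive show ?thesis
  proof eventually_elim
    case (elim i)
    interpret contractive_moments "N i" "r i" by (rule elim)
    have big: "4 * c ^ n \<le> \<kappa> * b n" using elim(3) k by (simp add: field_simps)
    have step: "c ^ n * b j \<le> b (n + j)" for j
    proof -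
      have "4 * c ^ n * b j \<le> \<kappa> * b n * b j" by (intro mult_right_mono big basis_moment_nonneg)
      also have "\<dots> \<le> 4 * b (n + j)"
        using elim(1) k by (intro supermultiplicative_if_spread) (auto simp: s_def)
      finally show ?thesis by simp
    qed
    show ?case
      unfolding growth_at_least_def
    proof (intro allI, rule ccontr)
      fix j assume "\<not> c ^ j \<le> b j"
      then have x: "0 \<le> b j / c ^ j" "b j / c ^ j < 1"
        using c basis_moment_nonneg by (auto simp: field_simps)
      have low: "2 * c ^ (n * l) \<le> b (n * l)" for l
      proof (induction l)
        case 0
        show ?case by (simp add: basis_moment_0)
      next
        case (Suc l)
        have "2 * c ^ (n * Suc l) = c ^ n * (2 * c ^ (n * l))" by (simp add: power_add)
        also have "\<dots> \<le> c ^ n * b (n * l)" using c by (intro mult_left_mono Suc) auto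
        also have "\<dots> \<le> b (n * Suc l)" using step[of "n * l"] by simp
        finally show ?case .
      qed
      have "1 \<le> (b j / c ^ j) ^ n"
      proof -
        have "2 * c ^ (n * j) \<le> 2 * b j ^ n"
          using low[of j] basis_moment_mult_le[of j n] by (simp add: mult.commute)
        then have "1 \<le> b j ^ n / c ^ (j * n)" using c by (simp add: pos_le_divide_eq mult.commute)
        then show ?thesis by (simp add: power_divide power_mult)
      qed
      then show False
        using power_less_one_iff[OF x(1), of n] n(2) x(2) by simp
    qed
  qed
qed

lemma entry_powr_tendsto:
  assumes "continuous_on UNIV e" "\<And>A. A \<in> op_ball \<Longrightarrow> \<bar>e A\<bar> \<le> 1"
  shows "((\<lambda>i. \<integral>A. \<bar>e A\<bar> powr r i \<partial>N i) \<longlongrightarrow> (\<integral>A. \<bar>e A\<bar> powr q \<partial>M)) F"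
  using abs_powr_mult_integral_tendsto[OF contractive_measures weak exponent M.r_pos assms, of "\<lambda>_. 1"]
  by simp

text \<open>The coefficients \<open>p\<close> and \<open>t\<close> of the certificate are chosen such that its two inequalities
hold for the limit measure \<open>M\<close> with slack exactly \<open>1\<close>. This is possible for every level \<open>d\<close> that
differs from both diagonal moments, and one of the coefficients is positive if \<open>d\<close> is below the
larger one. The slack absorbs the perturbation, including the lower left moment \<open>\<gamma>\<close> of \<open>N i\<close>,
which tends to \<open>\<gamma>(M) = 0\<close>.\<close>

lemma growth_lower_semicontinuous_reducible:
  assumes u: "norm u = 1" and inv: "(\<integral>A. \<bar>wedge u (A *v u)\<bar> \<partial>M) = 0"
    and growth: "growth_at_least M q c'" and c: "0 < c" "c < c'"
  shows "\<forall>\<^sub>F i in F. growth_at_least (N i) (r i) c"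
proof -
  define \<alpha> where "\<alpha> K p = (\<integral>A. \<bar>u \<bullet> (A *v u)\<bar> powr p \<partial>K)" for K :: "mat2 measure" and p
  define \<beta> where "\<beta> K p = (\<integral>A. \<bar>u \<bullet> (A *v perp u)\<bar> powr p \<partial>K)" for K :: "mat2 measure" and p
  define \<gamma> where "\<gamma> K p = (\<integral>A. \<bar>wedge u (A *v u)\<bar> powr p \<partial>K)" for K :: "mat2 measure" and p
  define \<delta> where "\<delta> K p = (\<integral>A. \<bar>wedge u (A *v perp u)\<bar> powr p \<partial>K)" for K :: "mat2 measure" and p
  have cont: "continuous_on UNIV (\<lambda>A::mat2. u \<bullet> (A *v x))"
    "continuous_on UNIV (\<lambda>A::mat2. wedge u (A *v x))" for x
    by (intro continuous_intros)+
  have bound: "\<bar>u \<bullet> (A *v x)\<bar> \<le> 1" "\<bar>wedge u (A *v x)\<bar> \<le> 1"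
    if A: "A \<in> op_ball" and x: "norm x = 1" for A x
  proof -
    have "norm (A *v x) \<le> 1" using A x op_ball_iff by metis
    then show "\<bar>u \<bullet> (A *v x)\<bar> \<le> 1" "\<bar>wedge u (A *v x)\<bar> \<le> 1"
      using Cauchy_Schwarz_ineq2[of u "A *v x"] abs_wedge_le[of u "A *v x"] u by auto
  qed
  have lim: "((\<lambda>i. \<alpha> (N i) (r i)) \<longlongrightarrow> \<alpha> M q) F" "((\<lambda>i. \<beta> (N i) (r i)) \<longlongrightarrow> \<beta> M q) F"
    "((\<lambda>i. \<gamma> (N i) (r i)) \<longlongrightarrow> \<gamma> M q) F" "((\<lambda>i. \<delta> (N i) (r i)) \<longlongrightarrow> \<delta> M q) F"
    unfolding \<alpha>_def \<beta>_def \<gamma>_def \<delta>_def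
    by (intro entry_powr_tendsto cont bound; simp add: u)+
  have "AE A in M. wedge u (A *v u) = 0"
    using inv integral_nonneg_eq_0_iff_AE[of M "\<lambda>A. \<bar>wedge u (A *v u)\<bar>"]
    by (simp add: M.integrable_continuous continuous_intros)
  then have "AE A in M. \<bar>wedge u (A *v u)\<bar> powr q = 0" by eventually_elim simp
  then have \<gamma>0: "\<gamma> M q = 0" unfolding \<gamma>_def by (rule integral_eq_zero_AE)
  have max: "c' \<le> max (\<alpha> M q) (\<delta> M q)"
    using M.triangular_growth_le[OF u inv growth] c by (simp add: \<alpha>_def \<delta>_def)
  \<comment> \<open>A level strictly between \<open>c\<close> and \<open>c'\<close> at which neither denominator below vanishes.\<close>
  have "infinite ({c<..<c'} - {\<alpha> M q, \<delta> M q})" using c by (intro Diff_infinite_finite) auto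
  then obtain d where "d \<in> {c<..<c'} - {\<alpha> M q, \<delta> M q}"
    using infinite_imp_nonempty by blast
  then have d: "c < d" "d < c'" "d \<noteq> \<alpha> M q" "d \<noteq> \<delta> M q" by auto
  define p where "p = 1 / (\<alpha> M q - d)"
  define t where "t = (\<bar>p\<bar> * \<beta> M q + 1) / (\<delta> M q - d)"
  have p1: "p * \<alpha> M q - d * p = 1"
    using d by (simp add: p_def diff_divide_distrib[symmetric])
  have t1: "t * \<delta> M q - d * t = \<bar>p\<bar> * \<beta> M q + 1"
  proof -
    have "t * \<delta> M q - d * t = t * (\<delta> M q - d)" by (simp add: algebra_simps)
    then show ?thesis using d by (simp add: t_def)
  qed
  have pos: "0 < p \<or> 0 < t"
  proof (cases "d < \<alpha> M q")
    case True
    then show ?thesis by (simp add: p_def)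
  next
    case False
    then have "d < \<delta> M q" using max d by (auto simp: le_max_iff_disj)
    moreover have "0 \<le> \<beta> M q" by (simp add: \<beta>_def)
    then have "0 < \<bar>p\<bar> * \<beta> M q + 1" by (simp add: add_nonneg_pos)
    ultimately show ?thesis by (simp add: t_def)
  qed
  have "((\<lambda>i. p * \<alpha> (N i) (r i) - \<bar>t\<bar> * \<gamma> (N i) (r i) - d * p) \<longlongrightarrow> p * \<alpha> M q - \<bar>t\<bar> * 0 - d * p) F"
    using lim \<gamma>0 by (intro tendsto_intros) auto
  then have ev1: "\<forall>\<^sub>F i in F. 0 < p * \<alpha> (N i) (r i) - \<bar>t\<bar> * \<gamma> (N i) (r i) - d * p"
    using p1 by (intro order_tendstoD(1)) auto
  have "((\<lambda>i. t * \<delta> (N i) (r i) - \<bar>p\<bar> * \<beta> (N i) (r i) - d * t) \<longlongrightarrow> t * \<delta> M q - \<bar>p\<bar> * \<beta> M q - d * t) F"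
    using lim by (intro tendsto_intros) auto
  then have ev2: "\<forall>\<^sub>F i in F. 0 < t * \<delta> (N i) (r i) - \<bar>p\<bar> * \<beta> (N i) (r i) - d * t"
    using t1 by (intro order_tendstoD(1)) auto
  from ev1 ev2 contractive show ?thesis
  proof eventually_elim
    case (elim i)
    interpret contractive_moments "N i" "r i" by (rule elim)
    have "growth_at_least (N i) (r i) d"
    proof (rule frame_superharmonic_growth[OF u _ pos])
      show "0 < d" using c d by simp
    qed (use elim in \<open>simp_all add: \<alpha>_def \<beta>_def \<gamma>_def \<delta>_def\<close>)
    then show ?case using growth_at_least_mono c d by auto
  qed
qed

lemma growth_lower_semicontinuous:
  assumes "growth_at_least M q c'" "0 < c" "c < c'"
  shows "\<forall>\<^sub>F i in F. growth_at_least (N i) (r i) c"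
  using growth_lower_semicontinuous_irreducible growth_lower_semicontinuous_reducible assms by blast

end

section \<open>Singular values in dimension two\<close>

definition gram_trace :: "mat2 \<Rightarrow> real" where
  "gram_trace A = (norm (A *v e1))\<^sup>2 + (norm (A *v e2))\<^sup>2"

lemma gram_discriminant:
  "(gram_trace A)\<^sup>2 - 4 * (det A)\<^sup>2
     = ((norm (A *v e1))\<^sup>2 - (norm (A *v e2))\<^sup>2)\<^sup>2 + 4 * ((A *v e1) \<bullet> (A *v e2))\<^sup>2"
  unfolding gram_trace_def det_eq_wedge_columns
  using wedge_sq_add_inner_sq[of "A *v e1" "A *v e2"]
  by (simp add: power2_eq_square algebra_simps)

lemma gram_mult:
  "(transpose A ** A) *v v = (\<chi> i. if i = 1
     then (norm (A *v e1))\<^sup>2 * v$1 + ((A *v e1) \<bullet> (A *v e2)) * v$2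
     else ((A *v e1) \<bullet> (A *v e2)) * v$1 + (norm (A *v e2))\<^sup>2 * v$2)" for A :: mat2
  unfolding vec_eq_iff forall_2 norm_sq_2 inner_2 mult_vec_2 matrix_matrix_mult_def transpose_def sum_2
  by (simp add: power2_eq_square algebra_simps)

lemma gram_eigenvalues_iff:
  "l \<in> gram_eigenvalues A \<longleftrightarrow> l\<^sup>2 - gram_trace A * l + (det A)\<^sup>2 = 0"
proof -
  define p where "p = (norm (A *v e1))\<^sup>2"
  define q where "q = (norm (A *v e2))\<^sup>2"
  define m where "m = (A *v e1) \<bullet> (A *v e2)"
  have d: "(det A)\<^sup>2 = p * q - m\<^sup>2"
    using wedge_sq_add_inner_sq[of "A *v e1" "A *v e2"]
    by (simp add: det_eq_wedge_columns p_def q_def m_def)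
  have char: "l\<^sup>2 - gram_trace A * l + (det A)\<^sup>2 = (p - l) * (q - l) - m * m"
    unfolding d gram_trace_def p_def[symmetric] q_def[symmetric]
    by (simp add: power2_eq_square algebra_simps)
  have eig: "(transpose A ** A) *v v = l *\<^sub>R v \<longleftrightarrow> (p - l) * v$1 + m * v$2 = 0 \<and> m * v$1 + (q - l) * v$2 = 0" for v
    unfolding gram_mult p_def[symmetric] q_def[symmetric] m_def[symmetric]
    by (auto simp: vec_eq_iff forall_2 algebra_simps)
  have nz: "v \<noteq> 0 \<longleftrightarrow> v$1 \<noteq> 0 \<or> v$2 \<noteq> 0" for v :: "real^2"
    by (auto simp: vec_eq_iff forall_2)
  have "l \<in> gram_eigenvalues A \<longleftrightarrow> (p - l) * (q - l) - m * m = 0"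
  proof
    assume "l \<in> gram_eigenvalues A"
    then obtain v :: "real^2" where v: "v$1 \<noteq> 0 \<or> v$2 \<noteq> 0"
      "(p - l) * v$1 + m * v$2 = 0" "m * v$1 + (q - l) * v$2 = 0"
      by (auto simp: gram_eigenvalues_def eig nz)
    have "((p - l) * (q - l) - m * m) * v$1 = (q - l) * ((p - l) * v$1 + m * v$2) - m * (m * v$1 + (q - l) * v$2)"
      "((p - l) * (q - l) - m * m) * v$2 = (p - l) * (m * v$1 + (q - l) * v$2) - m * ((p - l) * v$1 + m * v$2)"
      by (simp_all add: algebra_simps)
    then show "(p - l) * (q - l) - m * m = 0" using v by auto
  next
    assume *: "(p - l) * (q - l) - m * m = 0"
    have "\<exists>x y. (x \<noteq> 0 \<or> y \<noteq> 0) \<and> (p - l) * x + m * y = 0 \<and> m * x + (q - l) * y = 0"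
    proof (cases "m = 0")
      case False
      show ?thesis by (rule exI[of _ m], rule exI[of _ "l - p"]) (use False * in \<open>auto simp: algebra_simps\<close>)
    next
      case True
      then have "p = l \<or> q = l" using * by auto
      then show ?thesis
      proof
        assume "p = l" then show ?thesis using True by (intro exI[of _ 1] exI[of _ 0]) auto
      next
        assume "q = l" then show ?thesis using True by (intro exI[of _ 0] exI[of _ 1]) auto
      qed
    qed
    then obtain x y where xy: "x \<noteq> 0 \<or> y \<noteq> 0" "(p - l) * x + m * y = 0" "m * x + (q - l) * y = 0" by blast
    then show "l \<in> gram_eigenvalues A"
      unfolding gram_eigenvalues_def mem_Collect_eq eig nz
      by (intro exI[of _ "vector [x, y]"]) auto
  qed
  then show ?thesis using char by simp
qed

text \<open>The difference of the two eigenvalues of \<open>A\<^sup>T A\<close>.\<close>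

definition gram_gap :: "mat2 \<Rightarrow> real" where
  "gram_gap A = sqrt ((gram_trace A)\<^sup>2 - 4 * (det A)\<^sup>2)"

lemma gram_gap_square: "gram_gap A * gram_gap A = (gram_trace A)\<^sup>2 - 4 * (det A)\<^sup>2"
proof -
  have "(gram_trace A)\<^sup>2 - 4 * (det A)\<^sup>2 \<ge> 0"
    unfolding gram_discriminant by (intro add_nonneg_nonneg) auto
  then show ?thesis by (simp add: gram_gap_def)
qed

lemma gram_gap_nonneg: "0 \<le> gram_gap A"
  unfolding gram_gap_def gram_discriminant by simp

lemma gram_trace_nonneg: "0 \<le> gram_trace A" by (simp add: gram_trace_def)

lemma gram_gap_le_trace: "gram_gap A \<le> gram_trace A"
  unfolding gram_gap_def using gram_trace_nonneg by (intro real_le_lsqrt) auto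

lemma gram_eigenvalues_eq:
  "gram_eigenvalues A = {(gram_trace A + gram_gap A) / 2, (gram_trace A - gram_gap A) / 2}"
proof -
  define T where "T = gram_trace A"
  define R where "R = gram_gap A"
  have "4 * (l\<^sup>2 - T * l + (det A)\<^sup>2) = (2 * l - T - R) * (2 * l - T + R)" for l
    using gram_gap_square[of A] unfolding T_def R_def by (simp add: power2_eq_square algebra_simps)
  then have "l\<^sup>2 - T * l + (det A)\<^sup>2 = 0 \<longleftrightarrow> 2 * l - T - R = 0 \<or> 2 * l - T + R = 0" for l
    by (metis mult_eq_0_iff zero_neq_numeral)
  moreover have "2 * l - T - R = 0 \<longleftrightarrow> l = (T + R) / 2" for l by auto
  moreover have "2 * l - T + R = 0 \<longleftrightarrow> l = (T - R) / 2" for l by auto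
  ultimately show ?thesis
    unfolding set_eq_iff gram_eigenvalues_iff T_def[symmetric] R_def[symmetric] by simp
qed

lemma sigma_eq:
  "sigma1 A = sqrt ((gram_trace A + gram_gap A) / 2)"
  "sigma2 A = sqrt ((gram_trace A - gram_gap A) / 2)"
  unfolding sigma1_def sigma2_def gram_eigenvalues_eq
  using gram_gap_nonneg[of A] by (simp_all add: max_def min_def)

lemma sigma_nonneg: "0 \<le> sigma1 A" "0 \<le> sigma2 A"
  using gram_gap_le_trace[of A] gram_trace_nonneg[of A] gram_gap_nonneg[of A]
  by (auto simp: sigma_eq)

lemma sigma1_mult_sigma2: "sigma1 A * sigma2 A = \<bar>det A\<bar>"
proof -
  have "sigma1 A * sigma2 A = sqrt ((gram_trace A + gram_gap A) / 2 * ((gram_trace A - gram_gap A) / 2))"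
    by (simp only: sigma_eq real_sqrt_mult)
  also have "(gram_trace A + gram_gap A) / 2 * ((gram_trace A - gram_gap A) / 2) = (det A)\<^sup>2"
    using gram_gap_square[of A] by (simp add: power2_eq_square algebra_simps)
  finally show ?thesis by simp
qed

lemma sigma2_le_sigma1: "sigma2 A \<le> sigma1 A"
  using gram_gap_nonneg[of A] by (simp add: sigma_eq)

lemma norm_column_le_sigma1: "norm (A *v e1) \<le> sigma1 A" "norm (A *v e2) \<le> sigma1 A"
proof -
  define p where "p = (norm (A *v e1))\<^sup>2"
  define q where "q = (norm (A *v e2))\<^sup>2"
  have "(p - q)\<^sup>2 \<le> (gram_trace A)\<^sup>2 - 4 * (det A)\<^sup>2"
    unfolding gram_discriminant p_def q_def by simp
  then have "\<bar>p - q\<bar> \<le> gram_gap A"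
    unfolding gram_gap_def using real_sqrt_le_mono by fastforce
  then have "p - q \<le> gram_gap A" "q - p \<le> gram_gap A" by auto
  then have "p \<le> (gram_trace A + gram_gap A) / 2" "q \<le> (gram_trace A + gram_gap A) / 2"
    unfolding gram_trace_def p_def[symmetric] q_def[symmetric] by auto
  then show "norm (A *v e1) \<le> sigma1 A" "norm (A *v e2) \<le> sigma1 A"
    unfolding sigma_eq p_def q_def by (auto intro: real_le_rsqrt)
qed

lemma sigma1_le_norm_columns: "sigma1 A \<le> norm (A *v e1) + norm (A *v e2)"
proof -
  have "sigma1 A \<le> sqrt (gram_trace A)"
    unfolding sigma_eq using gram_gap_le_trace[of A] by simp
  also have "\<dots> \<le> norm (A *v e1) + norm (A *v e2)"
    unfolding gram_trace_def by (rule sqrt_sum_squares_le_sum) auto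
  finally show ?thesis .
qed

lemma sigma1_powr_bounds:
  assumes "0 < r" "r \<le> 1"
  shows "norm (A *v e1) powr r \<le> sigma1 A powr r" "norm (A *v e2) powr r \<le> sigma1 A powr r"
    "sigma1 A powr r \<le> norm (A *v e1) powr r + norm (A *v e2) powr r"
proof -
  show "norm (A *v e1) powr r \<le> sigma1 A powr r" "norm (A *v e2) powr r \<le> sigma1 A powr r"
    using norm_column_le_sigma1 assms by (auto intro!: powr_mono2)
  have "sigma1 A powr r \<le> (norm (A *v e1) + norm (A *v e2)) powr r"
    using sigma1_le_norm_columns sigma_nonneg assms by (intro powr_mono2) auto
  also have "\<dots> \<le> norm (A *v e1) powr r + norm (A *v e2) powr r"
    using assms by (intro powr_add_le) auto
  finally show "sigma1 A powr r \<le> norm (A *v e1) powr r + norm (A *v e2) powr r" .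
qed

text \<open>Writing \<open>\<sigma>\<^sub>2 = \<bar>det A\<bar> / \<sigma>\<^sub>1\<close> turns the singular value function into a multiplicative
weight times a power of the norm with exponent at most \<open>1\<close>.\<close>

lemma svf_between:
  assumes "1 < t" "t \<le> 2"
  shows "svf t A = \<bar>det A\<bar> powr (t - 1) * sigma1 A powr (2 - t)"
proof (cases "sigma1 A = 0")
  case True
  then show ?thesis using assms sigma1_mult_sigma2[of A] by (simp add: svf_def)
next
  case False
  then have s: "0 < sigma1 A" using sigma_nonneg[of A] by simp
  have "\<bar>det A\<bar> powr (t - 1) * sigma1 A powr (2 - t)
      = sigma2 A powr (t - 1) * (sigma1 A powr (t - 1) * sigma1 A powr (2 - t))"
    using sigma_nonneg[of A] by (simp add: sigma1_mult_sigma2[symmetric] powr_mult)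
  also have "sigma1 A powr (t - 1) * sigma1 A powr (2 - t) = sigma1 A"
    using s by (simp add: powr_add[symmetric])
  finally show ?thesis using assms by (simp add: svf_def)
qed

text \<open>Immediate from \<open>\<sigma>\<^sub>1(A)\<^sup>2 \<ge> \<sigma>\<^sub>1(A) \<sigma>\<^sub>2(A) = \<bar>det A\<bar>\<close>; for \<open>t = 1\<close> and singular \<open>A\<close> the left
side is \<open>0\<close>.\<close>

lemma det_powr_le_svf:
  assumes "1 \<le> t" "t \<le> 2"
  shows "\<bar>det A\<bar> powr (t / 2) \<le> svf t A"
proof -
  have d: "\<bar>det A\<bar> \<le> (sigma1 A)\<^sup>2"
    using mult_left_mono[OF sigma2_le_sigma1[of A] sigma_nonneg(1)[of A]]
    by (simp add: sigma1_mult_sigma2 power2_eq_square)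
  show ?thesis
  proof (cases "det A = 0")
    case True
    then show ?thesis using sigma_nonneg by (simp add: svf_def)
  next
    case False
    then have s: "0 < sigma1 A" using d sigma_nonneg(1)[of A] by (cases "sigma1 A = 0") auto
    have "\<bar>det A\<bar> powr ((2 - t) / 2) \<le> (sigma1 A)\<^sup>2 powr ((2 - t) / 2)"
      using d assms by (intro powr_mono2) auto
    also have "\<dots> = sigma1 A powr (2 - t)"
    proof -
      have "(sigma1 A)\<^sup>2 = sigma1 A powr 2" using s by simp
      then have "(sigma1 A)\<^sup>2 powr ((2 - t) / 2) = sigma1 A powr (2 * ((2 - t) / 2))"
        by (simp only: powr_powr)
      moreover have "2 * ((2 - t) / 2) = 2 - t" by simp
      ultimately show ?thesis by (simp only:)
    qed
    finally have 1: "\<bar>det A\<bar> powr ((2 - t) / 2) \<le> sigma1 A powr (2 - t)" .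
    have "\<bar>det A\<bar> powr (t / 2) = \<bar>det A\<bar> powr (t - 1) * \<bar>det A\<bar> powr ((2 - t) / 2)"
      by (simp add: powr_add[symmetric] field_simps)
    also have "\<dots> \<le> \<bar>det A\<bar> powr (t - 1) * sigma1 A powr (2 - t)"
      by (intro mult_left_mono 1) auto
    also have "\<dots> = svf t A"
    proof (cases "t = 1")
      case True
      then show ?thesis using False s by (simp add: svf_def)
    next
      case False
      then show ?thesis using svf_between assms by simp
    qed
    finally show ?thesis .
  qed
qed

section \<open>The pressure as a growth rate\<close>

lemma ln_ext_mono: "x \<le> y \<Longrightarrow> ln_ext x \<le> ln_ext y"
proof -
  assume le: "x \<le> y"
  show ?thesis
  proof (cases "x = 0 \<or> y = \<infinity>")
    case True
    then show ?thesis by (auto simp: ln_ext_def)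
  next
    case False
    then have "0 < x" "y < \<infinity>" using le by (auto simp: zero_less_iff_neq_zero less_top[symmetric])
    then have "0 < enn2real x" "enn2real x \<le> enn2real y"
      using le by (auto simp: enn2real_positive_iff enn2real_mono less_top[symmetric] top_unique)
    then show ?thesis using False le by (auto simp: ln_ext_def top_unique)
  qed
qed

lemma ln_ext_ennreal: "0 < x \<Longrightarrow> ln_ext (ennreal x) = ereal (ln x)"
  by (simp add: ln_ext_def ennreal_eq_0_iff not_le)

lemma ln_le_ln_ext_iff: "0 < c \<Longrightarrow> 0 \<le> d \<Longrightarrow> ereal (ln c) \<le> ln_ext (ennreal d) \<longleftrightarrow> c \<le> d"
  by (cases "d = 0") (auto simp: ln_ext_ennreal ln_ext_def)

lemma ln_rate_tendsto:
  "(\<lambda>n. ereal ((real n * y + x) / real n)) \<longlonglongrightarrow> ereal y"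
proof -
  have "(\<lambda>n. y + x / real n) \<longlonglongrightarrow> y + 0"
    by (intro tendsto_intros lim_const_over_n)
  moreover have "\<forall>\<^sub>F n in sequentially. y + x / real n = (real n * y + x) / real n"
    using eventually_gt_at_top[of 0] by eventually_elim (simp add: field_simps)
  ultimately have "(\<lambda>n. (real n * y + x) / real n) \<longlonglongrightarrow> y"
    using Lim_transform_eventually by fastforce
  then show ?thesis by simp
qed

context contractive_moments
begin

text \<open>The converse of the lower bound: one moment below \<open>c\<^sup>k\<close> bounds all moments at multiples of
\<open>k\<close>, and those in between since moments decrease. The constant \<open>(1 + 1/c)\<^sup>k\<close> bounds the loss
\<open>c\<^sup>-\<^sup>j\<close> for the remainder \<open>j < k\<close>, whether \<open>c\<close> is above or below \<open>1\<close>.\<close>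

lemma growth_upper_bound:
  assumes c: "0 < c" and ng: "\<not> growth_at_least N r c"
  shows "\<exists>C>0. \<forall>n. b n \<le> C * c ^ n"
proof -
  obtain k where k: "b k < c ^ k" using ng by (auto simp: growth_at_least_def not_le)
  have "b n \<le> 2 * (1 + 1 / c) ^ k * c ^ n" for n
  proof -
    have k0: "0 < k" using k by (cases k) (auto simp: basis_moment_0)
    define j where "j = n mod k"
    have n: "n = k * (n div k) + j" by (simp add: j_def)
    have "decseq b"
      unfolding decseq_Suc_iff basis_moment_def using moment_Suc_le by (auto intro: add_mono)
    then have "b n \<le> b (k * (n div k))" by (rule decseqD) simp
    also have "\<dots> \<le> 2 * b k ^ (n div k)" by (rule basis_moment_mult_le)
    also have "\<dots> \<le> 2 * (c ^ k) ^ (n div k)"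
      using k basis_moment_nonneg by (intro mult_left_mono power_mono) auto
    also have "\<dots> = 2 * (1 / c) ^ j * c ^ n"
      by (subst (2) n) (use c in \<open>simp add: power_add power_mult power_divide\<close>)
    also have "\<dots> \<le> 2 * (1 + 1 / c) ^ k * c ^ n"
    proof -
      have "(1 / c) ^ j \<le> (1 + 1 / c) ^ j" using c by (intro power_mono) auto
      also have "\<dots> \<le> (1 + 1 / c) ^ k" using c k0 by (intro power_increasing) (auto simp: j_def less_imp_le)
      finally show ?thesis using c by simp
    qed
    finally show ?thesis .
  qed
  then show ?thesis using c by (intro exI[of _ "2 * (1 + 1 / c) ^ k"]) (auto simp: add_pos_pos)
qed

text \<open>Fekete's lemma for sequences comparable with the basis moments. The limit is the supremum
of all \<open>ln c\<close> such that the rate is at least \<open>c\<close>, which is \<open>-\<infinity>\<close> if there is no such \<open>c\<close>; in this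
form vanishing moments need no separate treatment.\<close>

lemma exponential_rate:
  fixes I :: "nat \<Rightarrow> ennreal"
  assumes low: "\<And>n. ennreal (b n) \<le> 2 * I n" and up: "\<And>n. I n \<le> ennreal (b n)"
  defines "L \<equiv> lim (\<lambda>n. ereal (1 / real n) * ln_ext (I n))"
  shows "L < \<infinity>" and "0 < c \<Longrightarrow> ereal (ln c) \<le> L \<longleftrightarrow> growth_at_least N r c"
proof -
  define u where "u n = ereal (1 / real n) * ln_ext (I n)" for n
  define S where "S = {ereal (ln c) |c. 0 < c \<and> growth_at_least N r c}"
  have u_ge: "ereal ((real n * ln c + - ln 2) / real n) \<le> u n"
    if c: "0 < c" "growth_at_least N r c" for n c
  proof -
    have "ennreal (c ^ n / 2) \<le> I n"
    proof -
      have "ennreal (c ^ n) \<le> 2 * I n"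
        using c(2) low[of n] by (meson ennreal_leI growth_at_least_def order_trans)
      then have "ennreal (c ^ n) / 2 \<le> 2 * I n / 2" by (rule divide_right_mono_ennreal)
      moreover have "2 * I n / 2 = I n"
        by (simp add: ennreal_mult_divide_eq mult.commute)
      moreover have "ennreal (c ^ n) / 2 = ennreal (c ^ n / 2)"
        using c by (simp add: divide_ennreal[symmetric])
      ultimately show ?thesis by simp
    qed
    then have "ereal (ln (c ^ n / 2)) \<le> ln_ext (I n)"
      using ln_ext_mono ln_ext_ennreal[of "c ^ n / 2"] c by fastforce
    then have "ereal (1 / real n) * ereal (ln (c ^ n / 2)) \<le> u n"
      unfolding u_def by (intro ereal_mult_left_mono) auto
    then show ?thesis using c by (simp add: ln_div ln_realpow)
  qed
  have u_le: "\<exists>C. \<forall>n. u n \<le> ereal ((real n * ln c + ln C) / real n)"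
    if c: "0 < c" "\<not> growth_at_least N r c" for c
  proof -
    obtain C where C: "0 < C" "\<And>n. b n \<le> C * c ^ n" using growth_upper_bound c by blast
    have "u n \<le> ereal ((real n * ln c + ln C) / real n)" for n
    proof -
      have "I n \<le> ennreal (C * c ^ n)" using up[of n] C(2)[of n] ennreal_leI order_trans by blast
      then have "ln_ext (I n) \<le> ereal (ln (C * c ^ n))"
        using ln_ext_mono ln_ext_ennreal[of "C * c ^ n"] c C by fastforce
      then have "u n \<le> ereal (1 / real n) * ereal (ln (C * c ^ n))"
        unfolding u_def by (intro ereal_mult_left_mono) auto
      then show ?thesis using c C by (simp add: ln_mult ln_realpow add.commute)
    qed
    then show ?thesis by blast
  qed
  have "u \<longlonglongrightarrow> Sup S"
  proof (rule order_tendstoI)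
    fix a assume "a < Sup S"
    then obtain c where c: "0 < c" "growth_at_least N r c" "a < ereal (ln c)"
      by (auto simp: less_Sup_iff S_def)
    have "\<forall>\<^sub>F n in sequentially. a < ereal ((real n * ln c + - ln 2) / real n)"
      by (rule order_tendstoD(1)[OF ln_rate_tendsto c(3)])
    then show "\<forall>\<^sub>F n in sequentially. a < u n"
      by eventually_elim (use u_ge[OF c(1,2)] in \<open>meson less_le_trans\<close>)
  next
    fix a assume "Sup S < a"
    then obtain y where y: "Sup S < ereal y" "ereal y < a" using ereal_dense2 by blast
    have "\<not> growth_at_least N r (exp y)"
    proof
      assume "growth_at_least N r (exp y)"
      then have "ereal (ln (exp y)) \<in> S" unfolding S_def by (intro CollectI exI[of _ "exp y"]) auto
      then have "ereal y \<le> Sup S" using Sup_upper by fastforce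
      then show False using y by simp
    qed
    then obtain C where C: "\<And>n. u n \<le> ereal ((real n * y + ln C) / real n)"
      using u_le[of "exp y"] by auto
    have "\<forall>\<^sub>F n in sequentially. ereal ((real n * y + ln C) / real n) < a"
      by (rule order_tendstoD(2)[OF ln_rate_tendsto y(2)])
    then show "\<forall>\<^sub>F n in sequentially. u n < a"
      by eventually_elim (use C in \<open>meson le_less_trans\<close>)
  qed
  then have L: "L = Sup S" unfolding L_def u_def[abs_def] by (rule limI)
  have iff: "ereal (ln c) \<le> L \<longleftrightarrow> growth_at_least N r c" if c: "0 < c" for c
  proof
    assume "growth_at_least N r c"
    then show "ereal (ln c) \<le> L" unfolding L S_def using c by (intro Sup_upper) auto
  next
    assume le: "ereal (ln c) \<le> L"
    show "growth_at_least N r c"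
    proof (rule ccontr)
      assume "\<not> growth_at_least N r c"
      then obtain k where k: "b k < c ^ k" by (auto simp: growth_at_least_def not_le)
      then have k0: "0 < k" by (cases k) (auto simp: basis_moment_0)
      \<comment> \<open>The maximum with \<open>c / 2\<close> keeps \<open>\<rho>\<close> positive when \<open>b k = 0\<close>.\<close>
      define \<rho> where "\<rho> = max (root k (b k)) (c / 2)"
      have "root k (b k) < root k (c ^ k)" using k k0 by simp
      then have \<rho>: "0 < \<rho>" "\<rho> < c" using c k0 by (auto simp: \<rho>_def real_root_power_cancel)
      have "L \<le> ereal (ln \<rho>)"
        unfolding L S_def
      proof (rule Sup_least, clarify)
        fix d :: real assume d: "0 < d" "growth_at_least N r d"
        then have "root k (d ^ k) \<le> root k (b k)"
          using k0 by (simp add: growth_at_least_def)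
        then have "d \<le> \<rho>" using d k0 by (simp add: \<rho>_def real_root_power_cancel)
        then show "ereal (ln d) \<le> ereal (ln \<rho>)" using d by simp
      qed
      also have "\<dots> < ereal (ln c)" using \<rho> by simp
      finally show False using le by simp
    qed
  qed
  then show "0 < c \<Longrightarrow> ereal (ln c) \<le> L \<longleftrightarrow> growth_at_least N r c" .
  \<comment> \<open>The first basis moment is at most \<open>2\<close>, so the rate is below \<open>3\<close> and the limit is finite or \<open>-\<infinity>\<close>.\<close>
  have "\<not> growth_at_least N r 3"
  proof
    assume "growth_at_least N r 3"
    then have "3 ^ 1 \<le> b 1" unfolding growth_at_least_def by blast
    moreover have "b 1 \<le> 2"
      using moment_le_norm[of 1 e1] moment_le_norm[of 1 e2] by (simp add: basis_moment_def del: One_nat_def)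
    ultimately show False by simp
  qed
  then have "L < ereal (ln 3)" using iff[of 3] by (simp add: not_le[symmetric])
  then show "L < \<infinity>" using less_ereal.simps(2) less_trans by (metis less_ereal.simps(4) less_trans)
qed

end

lemma word_product_0: "word_product 0 A = mat 1"
  by (simp add: word_product_def)

lemma foldr_matrix_mult: "foldr (**) Bs (C::mat2) = foldr (**) Bs (mat 1) ** C"
  by (induction Bs) (simp_all add: matrix_mul_assoc)

lemma word_product_Suc: "word_product (Suc n) A = word_product n A ** A (Suc n)"
proof -
  have "word_product (Suc n) A = foldr (**) (map A [1..<Suc n]) (A (Suc n) ** mat 1)"
    by (simp add: word_product_def)
  also have "\<dots> = word_product n A ** A (Suc n)"
    unfolding word_product_def by (subst foldr_matrix_mult) simp
  finally show ?thesis .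
qed

lemma word_product_cong: "(\<And>i. i \<in> {1..n} \<Longrightarrow> A i = B i) \<Longrightarrow> word_product n A = word_product n B"
  by (induction n) (simp_all add: word_product_0 word_product_Suc)

lemma measurable_matrix_mult:
  fixes f g :: "'a \<Rightarrow> mat2"
  assumes "f \<in> borel_measurable K" "g \<in> borel_measurable K"
  shows "(\<lambda>x. f x ** g x) \<in> borel_measurable K"
  by (rule borel_measurable_continuous_Pair[OF assms]) (intro continuous_intros)

lemma measurable_mult_vec:
  fixes f :: "'a \<Rightarrow> mat2"
  assumes "f \<in> borel_measurable K"
  shows "(\<lambda>x. f x *v v) \<in> borel_measurable K"
  by (rule measurable_compose[OF assms borel_measurable_continuous_onI]) (intro continuous_intros)

context contractive_measure
begin

lemma sets_product: "sets (Pi\<^sub>M J (\<lambda>_. N)) = sets (Pi\<^sub>M J (\<lambda>_. borel))"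
  by (intro sets_PiM_cong refl sets_N)

lemma measurable_word_product:
  assumes "{1..n} \<subseteq> J"
  shows "word_product n \<in> borel_measurable (Pi\<^sub>M J (\<lambda>_. N))"
  using assms
proof (induction n)
  case 0
  then show ?case by (simp add: word_product_0[abs_def])
next
  case (Suc n)
  have "(\<lambda>A. A (Suc n)) \<in> measurable (Pi\<^sub>M J (\<lambda>_. borel)) borel"
    using Suc.prems by (intro measurable_component_singleton) auto
  then have "(\<lambda>A. A (Suc n)) \<in> borel_measurable (Pi\<^sub>M J (\<lambda>_. N))"
    by (simp cong: measurable_cong_sets add: sets_product)
  moreover have "{1..n} \<subseteq> J" using Suc.prems by (auto simp: subset_iff)
  then have "word_product n \<in> borel_measurable (Pi\<^sub>M J (\<lambda>_. N))" by (rule Suc.IH)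
  ultimately show ?case
    unfolding word_product_Suc[abs_def] by (intro measurable_matrix_mult)
qed

lemma nn_integral_product_law:
  assumes "F \<in> borel_measurable borel"
  shows "(\<integral>\<^sup>+A. F A \<partial>product_law N n) = (\<integral>\<^sup>+\<omega>. F (word_product n \<omega>) \<partial>Pi\<^sub>M {1..n} (\<lambda>_. N))"
  unfolding product_law_def using assms
  by (intro nn_integral_distr measurable_word_product) auto

lemma nn_integral_product_law_0:
  assumes "F \<in> borel_measurable borel"
  shows "(\<integral>\<^sup>+A. F A \<partial>product_law N 0) = F (mat 1)"
  using nn_integral_product_law[OF assms, of 0]
  by (simp add: word_product_0 PiM_empty nn_integral_count_space_finite)

text \<open>The last factor is split off, on the right of the word; it acts first on vectors, which
matches the recursion of the moments.\<close>

lemma nn_integral_product_law_Suc: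
  assumes F [measurable]: "F \<in> borel_measurable borel"
  shows "(\<integral>\<^sup>+A. F A \<partial>product_law N (Suc n)) = (\<integral>\<^sup>+B. (\<integral>\<^sup>+A. F (A ** B) \<partial>product_law N n) \<partial>N)"
proof -
  interpret product_sigma_finite "\<lambda>_::nat. N"
    by standard
  have ins: "{1..Suc n} = insert (Suc n) {1..n}" by auto
  have meas: "(\<lambda>\<omega>. F (word_product (Suc n) \<omega>)) \<in> borel_measurable (Pi\<^sub>M (insert (Suc n) {1..n}) (\<lambda>_. N))"
    using measurable_word_product[of "Suc n" "insert (Suc n) {1..n}"] F ins
    by (intro measurable_compose[OF _ F]) auto
  have FB: "(\<lambda>A::mat2. F (A ** B)) \<in> borel_measurable borel" for B
    by (rule measurable_compose[OF borel_measurable_continuous_onI F]) (intro continuous_intros)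
  have "(\<integral>\<^sup>+A. F A \<partial>product_law N (Suc n))
      = (\<integral>\<^sup>+B. (\<integral>\<^sup>+\<omega>. F (word_product (Suc n) (fun_upd \<omega> (Suc n) B)) \<partial>Pi\<^sub>M {1..n} (\<lambda>_. N)) \<partial>N)"
    unfolding nn_integral_product_law[OF F] ins
    by (rule product_nn_integral_insert_rev) (use meas in auto)
  also have "\<dots> = (\<integral>\<^sup>+B. (\<integral>\<^sup>+\<omega>. F (word_product n \<omega> ** B) \<partial>Pi\<^sub>M {1..n} (\<lambda>_. N)) \<partial>N)"
  proof -
    have "word_product (Suc n) (fun_upd \<omega> (Suc n) B) = word_product n \<omega> ** B" for \<omega> B
      using word_product_cong[of n "fun_upd \<omega> (Suc n) B" \<omega>] by (simp add: word_product_Suc)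
    then show ?thesis by simp
  qed
  finally show ?thesis unfolding nn_integral_product_law[OF FB] .
qed

end

definition weighted :: "mat2 measure \<Rightarrow> (mat2 \<Rightarrow> real) \<Rightarrow> mat2 measure" where
  "weighted \<nu> w = density \<nu> (\<lambda>A. ennreal (w A))"

definition multiplicative_weight :: "(mat2 \<Rightarrow> real) \<Rightarrow> bool" where
  "multiplicative_weight w \<longleftrightarrow> w \<in> borel_measurable borel \<and> (\<forall>A. 0 \<le> w A) \<and> (\<forall>A\<in>op_ball. w A \<le> 1)
     \<and> (\<forall>A B. w (A ** B) = w A * w B) \<and> w (mat 1) = 1"

context contractive_measure
begin

lemma measurable_N: "f \<in> borel_measurable borel \<Longrightarrow> f \<in> borel_measurable N"
  by (simp cong: measurable_cong_sets add: sets_N)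

lemma contractive_weighted:
  assumes w: "w \<in> borel_measurable borel" "\<And>A. 0 \<le> w A" "\<And>A. A \<in> op_ball \<Longrightarrow> w A \<le> 1"
  shows "contractive_measure (weighted N w)"
proof -
  have [measurable]: "w \<in> borel_measurable N" by (rule measurable_N[OF w(1)])
  have "emeasure (weighted N w) (space (weighted N w)) = (\<integral>\<^sup>+A. ennreal (w A) \<partial>N)"
    by (simp add: weighted_def emeasure_density cong: nn_integral_cong)
  also have "\<dots> \<le> (\<integral>\<^sup>+A. 1 \<partial>N)"
    using AE_op_ball w(3) by (intro nn_integral_mono_AE) (auto elim!: eventually_mono)
  also have "\<dots> \<le> 1"
    using mass_le_1 by (simp add: emeasure_eq_measure)
  finally have m: "emeasure (weighted N w) (space (weighted N w)) \<le> 1" .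
  show ?thesis
  proof (intro contractive_measure.intro finite_measureI contractive_measure_axioms.intro)
    show "emeasure (weighted N w) (space (weighted N w)) \<noteq> \<infinity>" using m by (auto simp: top_unique)
    show "sets (weighted N w) = sets borel" by (simp add: weighted_def sets_N)
    show "measure (weighted N w) (space (weighted N w)) \<le> 1"
      using m by (simp add: measure_def enn2real_leI)
    show "AE A in weighted N w. A \<in> op_ball"
      unfolding weighted_def using AE_op_ball by (subst AE_density) (auto elim!: eventually_mono)
  qed
qed

lemma integral_weighted:
  fixes h :: "mat2 \<Rightarrow> real"
  assumes w: "w \<in> borel_measurable borel" "\<And>A. 0 \<le> w A" and h: "continuous_on UNIV h"
  shows "integral\<^sup>L (weighted N w) h = (\<integral>A. w A * h A \<partial>N)"
  unfolding weighted_def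
  using measurable_N[OF w(1)] continuous_measurable[OF h] w(2) by (subst integral_density) auto

text \<open>Being multiplicative, the weight of a word factors into the weights of its letters, which
become the density of the measure.\<close>

lemma nn_integral_word_norm:
  assumes w: "multiplicative_weight w" and r: "0 < r" "r \<le> 1"
  shows "(\<integral>\<^sup>+A. ennreal (w A * norm (A *v v) powr r) \<partial>product_law N n) = ennreal (moment (weighted N w) r n v)"
proof -
  have w': "w \<in> borel_measurable borel" "\<And>A. 0 \<le> w A" "\<And>A. A \<in> op_ball \<Longrightarrow> w A \<le> 1"
    "\<And>A B. w (A ** B) = w A * w B" "w (mat 1) = 1"
    using w by (auto simp: multiplicative_weight_def)
  have meas: "(\<lambda>A. ennreal (w A * norm (A *v v) powr r)) \<in> borel_measurable borel" for v
    using w'(1) measurable_mult_vec[of "\<lambda>A. A" borel v] by measurable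
  show ?thesis
  proof (induction n arbitrary: v)
    case 0
    show ?case using w' by (simp add: nn_integral_product_law_0[OF meas])
  next
    case (Suc n)
    interpret W: contractive_measure "weighted N w" by (rule contractive_weighted[OF w'(1-3)])
    interpret W: contractive_moments "weighted N w" r by standard (use r in auto)
    have cont: "continuous_on UNIV (\<lambda>B::mat2. moment (weighted N w) r n (B *v v))"
      by (rule W.moment_orbit_continuous)
    have "(\<integral>\<^sup>+A. ennreal (w A * norm (A *v v) powr r) \<partial>product_law N (Suc n))
        = (\<integral>\<^sup>+B. (\<integral>\<^sup>+A. ennreal (w B) * ennreal (w A * norm (A *v (B *v v)) powr r) \<partial>product_law N n) \<partial>N)"
      unfolding nn_integral_product_law_Suc[OF meas]
      using w'(2) by (simp add: w'(4) ennreal_mult[symmetric] matrix_vector_mul_assoc mult_ac)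
    also have "\<dots> = (\<integral>\<^sup>+B. ennreal (w B) * ennreal (moment (weighted N w) r n (B *v v)) \<partial>N)"
      using meas Suc.IH by (subst nn_integral_cmult) (auto simp: product_law_def)
    also have "\<dots> = (\<integral>\<^sup>+B. ennreal (moment (weighted N w) r n (B *v v)) \<partial>weighted N w)"
      unfolding weighted_def[of N w] using measurable_N[OF w'(1)] continuous_measurable[OF cont]
      by (subst nn_integral_density) (auto simp: weighted_def)
    also have "\<dots> = ennreal (moment (weighted N w) r (Suc n) v)"
      using W.moment_nonneg W.integrable_continuous[OF cont] by (simp add: nn_integral_eq_integral)
    finally show ?case .
  qed
qed

text \<open>The largest singular value lies between the length of each column and the sum of the
lengths of both.\<close>

lemma nn_integral_svf_bounds:
  assumes w: "multiplicative_weight w" and r: "0 < r" "r \<le> 1"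
    and svf: "\<And>A. svf t A = w A * sigma1 A powr r"
  shows "ennreal (basis_moment (weighted N w) r n) \<le> 2 * (\<integral>\<^sup>+A. ennreal (svf t A) \<partial>product_law N n)"
    and "(\<integral>\<^sup>+A. ennreal (svf t A) \<partial>product_law N n) \<le> ennreal (basis_moment (weighted N w) r n)"
proof -
  have w': "w \<in> borel_measurable borel" "\<And>A. 0 \<le> w A" "\<And>A. A \<in> op_ball \<Longrightarrow> w A \<le> 1"
    using w by (auto simp: multiplicative_weight_def)
  interpret W: contractive_measure "weighted N w" by (rule contractive_weighted[OF w'])
  interpret W: contractive_moments "weighted N w" r by standard (use r in auto)
  define I where "I = (\<integral>\<^sup>+A. ennreal (svf t A) \<partial>product_law N n)" 
  have meas: "(\<lambda>A. ennreal (w A * norm (A *v v) powr r)) \<in> borel_measurable (product_law N n)" for v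
    unfolding product_law_def using w'(1) measurable_mult_vec[of "\<lambda>A. A" borel v] by measurable
  have ge: "ennreal (moment (weighted N w) r n e1) \<le> I" "ennreal (moment (weighted N w) r n e2) \<le> I" 
    unfolding I_def svf nn_integral_word_norm[OF w r, symmetric]
    using sigma1_powr_bounds[OF r] w'(2) by (intro nn_integral_mono ennreal_leI mult_left_mono; simp)+
  have low: "ennreal (basis_moment (weighted N w) r n) \<le> 2 * I" 
    unfolding basis_moment_def using add_mono[OF ge] W.moment_nonneg
    by (simp add: ennreal_plus[symmetric] mult_2 del: ennreal_plus)
  have up: "I \<le> ennreal (basis_moment (weighted N w) r n)" 
  proof -
    have "I \<le> (\<integral>\<^sup>+A. ennreal (w A * norm (A *v e1) powr r) + ennreal (w A * norm (A *v e2) powr r) \<partial>product_law N n)"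
      unfolding I_def svf
    proof (intro nn_integral_mono)
      fix A
      have "w A * sigma1 A powr r \<le> w A * norm (A *v e1) powr r + w A * norm (A *v e2) powr r"
        using mult_left_mono[OF sigma1_powr_bounds(3)[OF r, of A] w'(2)] by (simp add: distrib_left)
      then show "ennreal (w A * sigma1 A powr r) \<le> ennreal (w A * norm (A *v e1) powr r) + ennreal (w A * norm (A *v e2) powr r)"
        using w'(2) by (simp add: ennreal_plus[symmetric] ennreal_leI del: ennreal_plus)
    qed
    also have "\<dots> = ennreal (basis_moment (weighted N w) r n)"
      using W.moment_nonneg
      by (simp add: nn_integral_add meas nn_integral_word_norm[OF w r] basis_moment_def)
    finally show ?thesis .
  qed
  show "ennreal (basis_moment (weighted N w) r n) \<le> 2 * (\<integral>\<^sup>+A. ennreal (svf t A) \<partial>product_law N n)"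
    using low by (simp add: I_def)
  show "(\<integral>\<^sup>+A. ennreal (svf t A) \<partial>product_law N n) \<le> ennreal (basis_moment (weighted N w) r n)"
    using up by (simp add: I_def)
qed

lemma pressure_iff_growth:
  assumes w: "multiplicative_weight w" and r: "0 < r" "r \<le> 1"
    and svf: "\<And>A. svf t A = w A * sigma1 A powr r"
  shows "pressure N t < \<infinity>"
    and "0 < c \<Longrightarrow> ereal (ln c) \<le> pressure N t \<longleftrightarrow> growth_at_least (weighted N w) r c"
proof -
  have w': "w \<in> borel_measurable borel" "\<And>A. 0 \<le> w A" "\<And>A. A \<in> op_ball \<Longrightarrow> w A \<le> 1"
    using w by (auto simp: multiplicative_weight_def)
  interpret W: contractive_measure "weighted N w" by (rule contractive_weighted[OF w'])
  interpret W: contractive_moments "weighted N w" r by standard (use r in auto)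
  note bounds = nn_integral_svf_bounds[OF w r svf]
  show "pressure N t < \<infinity>"
    using W.exponential_rate(1)[OF bounds] by (simp add: pressure_def)
  show "0 < c \<Longrightarrow> ereal (ln c) \<le> pressure N t \<longleftrightarrow> growth_at_least (weighted N w) r c"
    using W.exponential_rate(2)[OF bounds] by (simp add: pressure_def)
qed

lemma pressure_le_1:
  assumes "0 < t" "t \<le> 1"
  shows "pressure N t < \<infinity>"
    and "0 < c \<Longrightarrow> ereal (ln c) \<le> pressure N t \<longleftrightarrow> growth_at_least N t c"
proof -
  have w: "multiplicative_weight (\<lambda>_. 1)" by (simp add: multiplicative_weight_def)
  have N: "weighted N (\<lambda>_. 1) = N" by (simp add: weighted_def density_1)
  show "pressure N t < \<infinity>"
    by (rule pressure_iff_growth(1)[OF w assms]) (use assms in \<open>simp add: svf_def\<close>)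
  show "0 < c \<Longrightarrow> ereal (ln c) \<le> pressure N t \<longleftrightarrow> growth_at_least N t c"
    using pressure_iff_growth(2)[OF w assms, of t c] assms by (simp add: svf_def N)
qed

end

section \<open>Determinant weights\<close>

lemma continuous_det_powr: "0 < p \<Longrightarrow> continuous_on UNIV (\<lambda>A::mat2. \<bar>det A\<bar> powr p)"
  by (intro continuous_abs_powr continuous_intros) auto

lemma det_powr_multiplicative_weight: "0 < p \<Longrightarrow> multiplicative_weight (\<lambda>A. \<bar>det A\<bar> powr p)"
proof -
  assume p: "0 < p"
  show ?thesis
    unfolding multiplicative_weight_def
    using p abs_det_le_1 continuous_det_powr
    by (auto simp: det_mul abs_mult powr_mult powr_le1 borel_measurable_continuous_onI)
qed

abbreviation det_weighted :: "mat2 measure \<Rightarrow> real \<Rightarrow> mat2 measure" where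
  "det_weighted \<nu> p \<equiv> weighted \<nu> (\<lambda>A. \<bar>det A\<bar> powr p)"

context contractive_measure
begin

lemma pressure_between_1_2:
  assumes "1 < t" "t < 2"
  shows "pressure N t < \<infinity>"
    and "0 < c \<Longrightarrow> ereal (ln c) \<le> pressure N t \<longleftrightarrow> growth_at_least (det_weighted N (t - 1)) (2 - t) c"
proof -
  have w: "multiplicative_weight (\<lambda>A. \<bar>det A\<bar> powr (t - 1))"
    using assms by (intro det_powr_multiplicative_weight) auto
  have r: "0 < 2 - t" "2 - t \<le> 1" using assms by auto
  have s: "svf t A = \<bar>det A\<bar> powr (t - 1) * sigma1 A powr (2 - t)" for A
    using svf_between assms by auto
  show "pressure N t < \<infinity>" by (rule pressure_iff_growth(1)[OF w r s])
  show "0 < c \<Longrightarrow> ereal (ln c) \<le> pressure N t \<longleftrightarrow> growth_at_least (det_weighted N (t - 1)) (2 - t) c"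
    by (rule pressure_iff_growth(2)[OF w r s])
qed

lemma nn_integral_word_det:
  assumes "0 < p"
  shows "(\<integral>\<^sup>+A. ennreal (\<bar>det A\<bar> powr p) \<partial>product_law N n) = ennreal ((\<integral>A. \<bar>det A\<bar> powr p \<partial>N) ^ n)"
proof -
  define d where "d = (\<integral>A. \<bar>det A\<bar> powr p \<partial>N)"
  have d0: "0 \<le> d" by (simp add: d_def)
  have cont: "continuous_on UNIV (\<lambda>A::mat2. \<bar>det A\<bar> powr p)"
    using assms by (intro continuous_abs_powr continuous_intros) auto
  have meas: "(\<lambda>A::mat2. ennreal (\<bar>det A\<bar> powr p)) \<in> borel_measurable borel"
    using borel_measurable_continuous_onI[OF cont] by measurable
  have "(\<integral>\<^sup>+A. ennreal (\<bar>det A\<bar> powr p) \<partial>product_law N n) = ennreal (d ^ n)"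
  proof (induction n)
    case 0
    show ?case by (simp add: nn_integral_product_law_0[OF meas])
  next
    case (Suc n)
    have "(\<integral>\<^sup>+A. ennreal (\<bar>det A\<bar> powr p) \<partial>product_law N (Suc n))
      = (\<integral>\<^sup>+B. (\<integral>\<^sup>+A. ennreal (\<bar>det B\<bar> powr p) * ennreal (\<bar>det A\<bar> powr p) \<partial>product_law N n) \<partial>N)"
      unfolding nn_integral_product_law_Suc[OF meas]
      by (simp add: det_mul abs_mult powr_mult ennreal_mult[symmetric] mult_ac)
    also have "\<dots> = (\<integral>\<^sup>+B. ennreal (\<bar>det B\<bar> powr p) * ennreal (d ^ n) \<partial>N)"
      using meas Suc.IH by (subst nn_integral_cmult) (auto simp: product_law_def)
    also have "\<dots> = (\<integral>\<^sup>+B. ennreal (\<bar>det B\<bar> powr p) \<partial>N) * ennreal (d ^ n)"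
      using measurable_N[OF meas] by (rule nn_integral_multc)
    also have "(\<integral>\<^sup>+B. ennreal (\<bar>det B\<bar> powr p) \<partial>N) = ennreal d"
      unfolding d_def using integrable_continuous[OF cont] by (intro nn_integral_eq_integral) auto
    finally show ?case using d0 by (simp add: ennreal_mult)
  qed
  then show ?thesis by (simp add: d_def)
qed

lemma pressure_ge_2:
  assumes "2 \<le> t"
  shows "pressure N t = ln_ext (ennreal (\<integral>A. \<bar>det A\<bar> powr (t / 2) \<partial>N))"
proof -
  define d where "d = (\<integral>A. \<bar>det A\<bar> powr (t / 2) \<partial>N)"
  have d0: "0 \<le> d" by (simp add: d_def)
  have svf: "svf t A = \<bar>det A\<bar> powr (t / 2)" for A
  proof (cases "t = 2")
    case True
    then show ?thesis using sigma1_mult_sigma2[of A] sigma_nonneg[of A] by (simp add: svf_def)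
  next
    case False
    then show ?thesis using assms by (simp add: svf_def)
  qed
  have I: "(\<integral>\<^sup>+A. ennreal (svf t A) \<partial>product_law N n) = ennreal (d ^ n)" for n
    unfolding svf d_def using assms by (intro nn_integral_word_det) auto
  have "\<forall>\<^sub>F n in sequentially. ln_ext (ennreal d) = ereal (1 / real n) * ln_ext (ennreal (d ^ n))"
    using eventually_gt_at_top[of 0]
  proof eventually_elim
    case (elim n)
    show ?case
    proof (cases "d = 0")
      case True
      then show ?thesis using elim by (simp add: ln_ext_def)
    next
      case False
      then have "0 < d" using d0 by simp
      then show ?thesis using elim by (simp add: ln_ext_ennreal ln_realpow)
    qed
  qed
  then have "(\<lambda>n. ereal (1 / real n) * ln_ext (ennreal (d ^ n))) \<longlonglongrightarrow> ln_ext (ennreal d)"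
    by (rule Lim_transform_eventually[OF tendsto_const])
  then show ?thesis unfolding pressure_def I d_def[symmetric] by (rule limI)
qed

end

text \<open>The function \<open>\<bar>v\<bar>\<^sup>r\<close> itself is expanded at most by the mass, because the matrices are
contractions.\<close>

lemma (in contractive_moments) growth_le_mass:
  assumes "growth_at_least N r c" "0 < c"
  shows "c \<le> measure N (space N)"
proof (rule subharmonic_growth[of _ 1 "\<lambda>v. norm v powr r"])
  fix v :: "real^2"
  have "(\<integral>A. norm (A *v v) powr r \<partial>N) \<le> (\<integral>A. norm v powr r \<partial>N)"
    using moment_orbit_continuous[of 0 v] r_pos op_ball_iff
    by (intro integral_mono_op_ball) (auto intro!: powr_mono2)
  then show "(\<integral>A. norm (A *v v) powr r \<partial>N) \<le> measure N (space N) * norm v powr r" by simp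
qed (use assms moment_continuous[of 0] in auto)

lemma (in contractive_measure) moment_weighted_mono:
  assumes r: "0 < r" "r \<le> 1"
    and w: "continuous_on UNIV w" "\<And>A. 0 \<le> w A" "\<And>A. A \<in> op_ball \<Longrightarrow> w A \<le> w' A"
    and w': "continuous_on UNIV w'" "\<And>A. 0 \<le> w' A" "\<And>A. A \<in> op_ball \<Longrightarrow> w' A \<le> 1"
  shows "moment (weighted N w) r n v \<le> moment (weighted N w') r n v"
proof (induction n arbitrary: v)
  case 0
  show ?case by simp
next
  case (Suc n)
  have meas: "w \<in> borel_measurable borel" "w' \<in> borel_measurable borel"
    using w w' borel_measurable_continuous_onI by blast+
  interpret W: contractive_measure "weighted N w"
    using contractive_weighted[OF meas(1) w(2)] w(3) w'(3) by (meson order_trans)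
  interpret W': contractive_measure "weighted N w'"
    using contractive_weighted[OF meas(2) w'(2,3)] .
  interpret W: contractive_moments "weighted N w" r by standard (use r in auto)
  interpret W': contractive_moments "weighted N w'" r by standard (use r in auto)
  have "moment (weighted N w) r (Suc n) v = (\<integral>A. w A * W.m n (A *v v) \<partial>N)"
    by (simp add: integral_weighted[OF meas(1) w(2) W.moment_orbit_continuous])
  also have "\<dots> \<le> (\<integral>A. w' A * W'.m n (A *v v) \<partial>N)"
    using w w' Suc.IH W.moment_nonneg
    by (intro integral_mono_op_ball continuous_on_mult W.moment_orbit_continuous
        W'.moment_orbit_continuous mult_mono) auto
  also have "\<dots> = moment (weighted N w') r (Suc n) v"
    by (simp add: integral_weighted[OF meas(2) w'(2) W'.moment_orbit_continuous])
  finally show ?case .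
qed

lemma (in contractive_measure) growth_weighted_mono:
  assumes "0 < r" "r \<le> 1"
    and "continuous_on UNIV w" "\<And>A. 0 \<le> w A" "\<And>A. A \<in> op_ball \<Longrightarrow> w A \<le> w' A"
    and "continuous_on UNIV w'" "\<And>A. 0 \<le> w' A" "\<And>A. A \<in> op_ball \<Longrightarrow> w' A \<le> 1"
    and "growth_at_least (weighted N w) r c"
  shows "growth_at_least (weighted N w') r c"
  using assms(9) moment_weighted_mono[OF assms(1-8)]
  unfolding growth_at_least_def basis_moment_def by (meson add_mono order_trans)

lemma (in contractive_measure) contractive_det_weighted:
  "0 < p \<Longrightarrow> contractive_measure (det_weighted N p)"
  using det_powr_multiplicative_weight[of p]
  by (intro contractive_weighted) (auto simp: multiplicative_weight_def)

lemma (in contractive_measure) integral_det_weighted: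
  "0 < p \<Longrightarrow> continuous_on UNIV h \<Longrightarrow>
     integral\<^sup>L (det_weighted N p) h = (\<integral>A. \<bar>det A\<bar> powr p * h A \<partial>N)"
  by (intro integral_weighted borel_measurable_continuous_onI continuous_det_powr) auto

lemma (in contractive_measure) mass_det_weighted:
  "0 < p \<Longrightarrow> measure (det_weighted N p) (space (det_weighted N p)) = (\<integral>A. \<bar>det A\<bar> powr p \<partial>N)"
  using integral_det_weighted[of p "\<lambda>_. 1"] by simp

lemma weakly_convergent_det_weighted:
  assumes con: "\<forall>\<^sub>F i in F. contractive_measure (\<nu> i)" and \<mu>: "contractive_measure \<mu>"
    and wc: "weakly_convergent \<nu> \<mu> F" and p: "(p \<longlongrightarrow> q) F" "0 < q"
  shows "weakly_convergent (\<lambda>i. det_weighted (\<nu> i) (p i)) (det_weighted \<mu> q) F"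
  unfolding weakly_convergent_def
proof (intro allI impI)
  fix h :: "mat2 \<Rightarrow> real" assume h: "continuous_on UNIV h"
  have "((\<lambda>i. \<integral>A. \<bar>det A\<bar> powr p i * h A \<partial>\<nu> i) \<longlongrightarrow> (\<integral>A. \<bar>det A\<bar> powr q * h A \<partial>\<mu>)) F"
    by (intro abs_powr_mult_integral_tendsto con wc p h abs_det_le_1 continuous_intros)
  moreover have "\<forall>\<^sub>F i in F. 0 < p i" using p by (rule order_tendstoD)
  then have "\<forall>\<^sub>F i in F. (\<integral>A. \<bar>det A\<bar> powr p i * h A \<partial>\<nu> i) = integral\<^sup>L (det_weighted (\<nu> i) (p i)) h"
    using con by eventually_elim (simp add: contractive_measure.integral_det_weighted h)
  ultimately show "((\<lambda>i. integral\<^sup>L (det_weighted (\<nu> i) (p i)) h) \<longlongrightarrow> integral\<^sup>L (det_weighted \<mu> q) h) F"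
    using contractive_measure.integral_det_weighted[OF \<mu> p(2) h] by (simp add: Lim_transform_eventually)
qed

lemma (in contractive_measure) invertible_part_eq_weighted:
  "invertible_part N = weighted N (\<lambda>A. if det A = 0 then 0 else 1)"
  unfolding invertible_part_eq_density[OF sets_N] weighted_def
  by (intro arg_cong[of _ _ "density N"]) (auto simp: fun_eq_iff indicator_def)

lemma measurable_det_zero_weight: "(\<lambda>A::mat2. if det A = 0 then 0 else 1 :: real) \<in> borel_measurable borel"
proof -
  have [measurable]: "(det :: mat2 \<Rightarrow> real) \<in> borel_measurable borel"
    by (intro borel_measurable_continuous_onI continuous_intros)
  show ?thesis by measurable
qed

lemma (in contractive_measure) contractive_invertible_part: "contractive_measure (invertible_part N)"
  unfolding invertible_part_eq_weighted
  by (intro contractive_weighted measurable_det_zero_weight) auto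

text \<open>Pointwise \<open>\<bar>det A\<bar>\<^sup>p \<rightarrow> 1\<close> if \<open>A\<close> is invertible and \<open>\<bar>det A\<bar>\<^sup>p = 0\<close> otherwise; dominated
convergence does the rest.\<close>

lemma (in contractive_measure) det_weighted_to_invertible_part:
  assumes p: "p \<longlonglongrightarrow> 0" "\<And>k. 0 < p k"
  shows "weakly_convergent (\<lambda>k. det_weighted N (p k)) (invertible_part N) sequentially"
  unfolding weakly_convergent_def
proof (intro allI impI)
  fix h :: "mat2 \<Rightarrow> real" assume h: "continuous_on UNIV h"
  have "(\<lambda>k. \<integral>A. \<bar>det A\<bar> powr p k * h A \<partial>N) \<longlonglongrightarrow> (\<integral>A. (if det A = 0 then 0 else 1) * h A \<partial>N)"
  proof (rule integral_dominated_convergence[where w = "\<lambda>A. \<bar>h A\<bar>"])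
    show "(\<lambda>A. (if det A = 0 then 0 else 1) * h A) \<in> borel_measurable N"
      by (intro borel_measurable_times measurable_N[OF measurable_det_zero_weight] continuous_measurable h)
    show "integrable N (\<lambda>A. \<bar>h A\<bar>)" by (intro integrable_continuous continuous_intros h)
    show "(\<lambda>A. \<bar>det A\<bar> powr p k * h A) \<in> borel_measurable N" for k
      by (intro continuous_measurable continuous_on_mult h continuous_det_powr p)
    show "AE A in N. (\<lambda>k. \<bar>det A\<bar> powr p k * h A) \<longlonglongrightarrow> (if det A = 0 then 0 else 1) * h A"
    proof (rule AE_I2)
      fix A :: mat2
      show "(\<lambda>k. \<bar>det A\<bar> powr p k * h A) \<longlonglongrightarrow> (if det A = 0 then 0 else 1) * h A"
      proof (cases "det A = 0")
        case False
        then have "(\<lambda>k. \<bar>det A\<bar> powr p k * h A) \<longlonglongrightarrow> \<bar>det A\<bar> powr 0 * h A"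
          by (intro tendsto_intros p) auto
        then show ?thesis using False by simp
      qed simp
    qed
    show "AE A in N. norm (\<bar>det A\<bar> powr p k * h A) \<le> \<bar>h A\<bar>" for k
      using AE_op_ball
    proof eventually_elim
      case (elim A)
      have "\<bar>det A\<bar> powr p k \<le> 1" using abs_det_le_1[OF elim] p(2)[of k] by (intro powr_le1) auto
      then show ?case by (simp add: abs_mult mult_left_le_one_le)
    qed
  qed
  then show "(\<lambda>k. integral\<^sup>L (det_weighted N (p k)) h) \<longlonglongrightarrow> integral\<^sup>L (invertible_part N) h"
    using h p(2)
    by (simp add: integral_det_weighted invertible_part_eq_weighted integral_weighted measurable_det_zero_weight)
qed

section \<open>Limits of the pressure\<close>

text \<open>Real levels \<open>ln c\<close> detect convergence to any limit, \<open>-\<infinity>\<close> included. In the lower bound a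
gap between the levels \<open>c\<close> and \<open>c'\<close> is allowed, since perturbation arguments lose a little.\<close>

lemma ereal_tendsto_by_log_levels:
  assumes low: "\<And>c c'. 0 < c \<Longrightarrow> c < c' \<Longrightarrow> ereal (ln c') \<le> P \<Longrightarrow> \<forall>\<^sub>F i in F. ereal (ln c) \<le> p i"
    and up: "\<And>c. 0 < c \<Longrightarrow> P < ereal (ln c) \<Longrightarrow> \<forall>\<^sub>F i in F. p i \<le> ereal (ln c)"
  shows "(p \<longlongrightarrow> P) F"
proof (rule order_tendstoI)
  fix a assume "a < P"
  then obtain y where y: "a < ereal y" "ereal y < P" using ereal_dense2 by blast
  then obtain z where z: "ereal y < ereal z" "ereal z < P" using ereal_dense2 by blast
  have "\<forall>\<^sub>F i in F. ereal (ln (exp y)) \<le> p i" by (rule low[of _ "exp z"]) (use z in auto)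
  then show "\<forall>\<^sub>F i in F. a < p i" by eventually_elim (use y in auto)
next
  fix a assume "P < a"
  then obtain y where y: "P < ereal y" "ereal y < a" using ereal_dense2 by blast
  have "\<forall>\<^sub>F i in F. p i \<le> ereal (ln (exp y))" by (rule up) (use y in auto)
  then show "\<forall>\<^sub>F i in F. p i < a" by eventually_elim (use y in auto)
qed

lemma (in converging_measures) tendsto_if_growth:
  assumes P: "\<And>c. 0 < c \<Longrightarrow> ereal (ln c) \<le> P \<longleftrightarrow> growth_at_least M q c"
    and p: "\<forall>\<^sub>F i in F. \<forall>c>0. ereal (ln c) \<le> p i \<longleftrightarrow> growth_at_least (N i) (r i) c"
  shows "(p \<longlongrightarrow> P) F"
proof (rule ereal_tendsto_by_log_levels)
  fix c c' :: real assume c: "0 < c" "c < c'" "ereal (ln c') \<le> P"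
  then have "growth_at_least M q c'" using P[of c'] by simp
  from growth_lower_semicontinuous[OF this c(1,2)] p
  show "\<forall>\<^sub>F i in F. ereal (ln c) \<le> p i" by eventually_elim (use c in simp)
next
  fix c :: real assume c: "0 < c" "P < ereal (ln c)"
  then have "\<not> growth_at_least M q c" using P[of c] by (simp add: not_le[symmetric])
  from growth_upper_semicontinuous[OF this] p
  show "\<forall>\<^sub>F i in F. p i \<le> ereal (ln c)"
  proof eventually_elim
    case (elim i)
    then have "\<not> ereal (ln c) \<le> p i" using c by simp
    then show ?case by (simp add: not_le)
  qed
qed

lemma tendsto_split:
  assumes "(f \<longlongrightarrow> l) (inf F (principal {i. Q i}))" "(f \<longlongrightarrow> l) (inf F (principal {i. \<not> Q i}))"
  shows "(f \<longlongrightarrow> l) F"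
proof (rule topological_tendstoI)
  fix S assume S: "open S" "l \<in> S"
  have "\<forall>\<^sub>F i in F. i \<in> {i. Q i} \<longrightarrow> f i \<in> S" "\<forall>\<^sub>F i in F. i \<in> {i. \<not> Q i} \<longrightarrow> f i \<in> S"
    using assms[THEN topological_tendstoD, OF S] by (simp_all add: eventually_inf_principal)
  then show "\<forall>\<^sub>F i in F. f i \<in> S" by eventually_elim auto
qed

locale converging_pairs =
  fixes \<nu> :: "'i \<Rightarrow> mat2 measure" and \<mu> :: "mat2 measure" and t :: "'i \<Rightarrow> real" and s :: real
    and F :: "'i filter"
  assumes contractive: "\<forall>\<^sub>F i in F. contractive_measure (\<nu> i)"
    and limit_contractive: "contractive_measure \<mu>"
    and weak: "weakly_convergent \<nu> \<mu> F"
    and parameter: "(t \<longlongrightarrow> s) F" and s_pos: "0 < s"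
begin

interpretation \<mu>: contractive_measure \<mu> by (rule limit_contractive)

lemma restrict: "converging_pairs \<nu> \<mu> t s (inf F (principal S))"
proof (rule converging_pairs.intro)
  have le: "inf F (principal S) \<le> F" by simp
  show "\<forall>\<^sub>F i in inf F (principal S). contractive_measure (\<nu> i)"
    using contractive filter_leD[OF le] by blast
  show "weakly_convergent \<nu> \<mu> (inf F (principal S))"
    using weak tendsto_mono[OF le] unfolding weakly_convergent_def by blast
  show "(t \<longlongrightarrow> s) (inf F (principal S))" using parameter tendsto_mono[OF le] by blast
qed (rule limit_contractive s_pos)+

lemma converging_measures_det_weighted:
  assumes "(p \<longlongrightarrow> q) F" "0 < q" "(r \<longlongrightarrow> r0) F" "0 < r0" "r0 \<le> 1" "\<forall>\<^sub>F i in F. r i \<le> 1"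
  shows "converging_measures (\<lambda>i. det_weighted (\<nu> i) (p i)) (det_weighted \<mu> q) r r0 F"
proof (rule converging_measures.intro)
  have "\<forall>\<^sub>F i in F. 0 < p i" "\<forall>\<^sub>F i in F. 0 < r i"
    using assms order_tendstoD(1) by blast+
  then show "\<forall>\<^sub>F i in F. contractive_moments (det_weighted (\<nu> i) (p i)) (r i)"
    using contractive assms(6)
    by eventually_elim
      (simp add: contractive_moments_def contractive_moments_axioms_def contractive_measure.contractive_det_weighted)
  show "contractive_moments (det_weighted \<mu> q) r0"
    using assms by (simp add: contractive_moments_def contractive_moments_axioms_def \<mu>.contractive_det_weighted)
  show "weakly_convergent (\<lambda>i. det_weighted (\<nu> i) (p i)) (det_weighted \<mu> q) F"
    by (intro weakly_convergent_det_weighted contractive limit_contractive weak assms)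
qed (rule assms)

lemma converging_measures_unweighted:
  assumes "(r \<longlongrightarrow> r0) F" "0 < r0" "r0 \<le> 1" "\<forall>\<^sub>F i in F. r i \<le> 1"
  shows "converging_measures \<nu> \<mu> r r0 F"
proof (rule converging_measures.intro)
  have "\<forall>\<^sub>F i in F. 0 < r i" using assms order_tendstoD(1) by blast
  then show "\<forall>\<^sub>F i in F. contractive_moments (\<nu> i) (r i)"
    using contractive assms(4)
    by eventually_elim (simp add: contractive_moments_def contractive_moments_axioms_def)
  show "contractive_moments \<mu> r0"
    using assms by (simp add: contractive_moments_def contractive_moments_axioms_def limit_contractive)
qed (rule assms weak)+

lemma det_integral_tendsto:
  assumes "(p \<longlongrightarrow> q) F" "0 < q"
  shows "((\<lambda>i. \<integral>A. \<bar>det A\<bar> powr p i \<partial>\<nu> i) \<longlongrightarrow> (\<integral>A. \<bar>det A\<bar> powr q \<partial>\<mu>)) F"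
  using abs_powr_mult_integral_tendsto[OF contractive weak assms, of det "\<lambda>_. 1"] abs_det_le_1
  by (simp add: continuous_intros)

lemma pressure_tendsto_le_1:
  assumes "s \<le> 1" "\<forall>\<^sub>F i in F. t i \<le> 1"
  shows "((\<lambda>i. pressure (\<nu> i) (t i)) \<longlongrightarrow> pressure \<mu> s) F"
proof -
  interpret C: converging_measures \<nu> \<mu> t s F
    by (rule converging_measures_unweighted[OF parameter s_pos assms])
  show ?thesis
  proof (rule C.tendsto_if_growth)
    show "ereal (ln c) \<le> pressure \<mu> s \<longleftrightarrow> growth_at_least \<mu> s c" if "0 < c" for c
      using \<mu>.pressure_le_1(2)[OF s_pos assms(1) that] .
    have "\<forall>\<^sub>F i in F. 0 < t i" using parameter s_pos order_tendstoD(1) by blast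
    then show "\<forall>\<^sub>F i in F. \<forall>c>0. ereal (ln c) \<le> pressure (\<nu> i) (t i) \<longleftrightarrow> growth_at_least (\<nu> i) (t i) c"
      using assms(2) contractive
      by eventually_elim (simp add: contractive_measure.pressure_le_1(2))
  qed
qed

lemma pressure_tendsto_between_1_2:
  assumes s: "1 < s" "s < 2"
  shows "((\<lambda>i. pressure (\<nu> i) (t i)) \<longlongrightarrow> pressure \<mu> s) F"
proof -
  have t: "\<forall>\<^sub>F i in F. 1 < t i" "\<forall>\<^sub>F i in F. t i < 2" using parameter s order_tendstoD by blast+
  interpret C: converging_measures "\<lambda>i. det_weighted (\<nu> i) (t i - 1)" "det_weighted \<mu> (s - 1)"
    "\<lambda>i. 2 - t i" "2 - s" F
    using s t by (intro converging_measures_det_weighted tendsto_intros parameter) (auto elim: eventually_mono)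
  show ?thesis
  proof (rule C.tendsto_if_growth)
    show "ereal (ln c) \<le> pressure \<mu> s \<longleftrightarrow> growth_at_least (det_weighted \<mu> (s - 1)) (2 - s) c" if "0 < c" for c
      using \<mu>.pressure_between_1_2(2)[OF s that] .
    show "\<forall>\<^sub>F i in F. \<forall>c>0. ereal (ln c) \<le> pressure (\<nu> i) (t i)
        \<longleftrightarrow> growth_at_least (det_weighted (\<nu> i) (t i - 1)) (2 - t i) c"
      using t contractive by eventually_elim (simp add: contractive_measure.pressure_between_1_2(2))
  qed
qed

lemma pressure_tendsto_ge_2:
  assumes s: "2 \<le> s" and t: "\<forall>\<^sub>F i in F. 2 \<le> t i"
  shows "((\<lambda>i. pressure (\<nu> i) (t i)) \<longlongrightarrow> pressure \<mu> s) F"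
proof -
  have lim: "((\<lambda>i. \<integral>A. \<bar>det A\<bar> powr (t i / 2) \<partial>\<nu> i) \<longlongrightarrow> (\<integral>A. \<bar>det A\<bar> powr (s / 2) \<partial>\<mu>)) F"
    using s by (intro det_integral_tendsto tendsto_intros parameter) auto
  have iff: "ereal (ln c) \<le> pressure N u \<longleftrightarrow> c \<le> (\<integral>A. \<bar>det A\<bar> powr (u / 2) \<partial>N)"
    if "contractive_measure N" "2 \<le> u" "0 < c" for N u c
    by (simp add: contractive_measure.pressure_ge_2 that ln_le_ln_ext_iff)
  show ?thesis
  proof (rule ereal_tendsto_by_log_levels)
    fix c c' :: real assume c: "0 < c" "c < c'" "ereal (ln c') \<le> pressure \<mu> s"
    then have "c < (\<integral>A. \<bar>det A\<bar> powr (s / 2) \<partial>\<mu>)"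
      using iff[OF limit_contractive s, of c'] by simp
    from order_tendstoD(1)[OF lim this] t contractive
    show "\<forall>\<^sub>F i in F. ereal (ln c) \<le> pressure (\<nu> i) (t i)"
      by eventually_elim (simp add: iff c)
  next
    fix c :: real assume c: "0 < c" "pressure \<mu> s < ereal (ln c)"
    then have "(\<integral>A. \<bar>det A\<bar> powr (s / 2) \<partial>\<mu>) < c"
      using iff[OF limit_contractive s, of c] by (simp add: not_le[symmetric])
    from order_tendstoD(2)[OF lim this] t contractive
    show "\<forall>\<^sub>F i in F. pressure (\<nu> i) (t i) \<le> ereal (ln c)"
    proof eventually_elim
      case (elim i)
      then have "\<not> ereal (ln c) \<le> pressure (\<nu> i) (t i)" using iff c by simp
      then show ?case by (simp add: not_le)
    qed
  qed
qed

text \<open>The exponent \<open>2 - t\<close> tends to \<open>0\<close> here, so that the continuity of the growth rate does not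
apply. Instead the pressure is squeezed: \<open>\<phi>\<^sup>t(A) \<ge> \<bar>det A\<bar>\<^sup>t\<^sup>/\<^sup>2\<close>, which is multiplicative, and
the growth rate is at most the mass \<open>\<integral> \<bar>det A\<bar>\<^sup>t\<^sup>-\<^sup>1\<close>. Both bounds have the same limit
\<open>\<integral> \<bar>det A\<bar>\<close>.\<close>

lemma pressure_tendsto_2_from_below:
  assumes s: "s = 2" and t2: "\<forall>\<^sub>F i in F. t i < 2"
  shows "((\<lambda>i. pressure (\<nu> i) (t i)) \<longlongrightarrow> pressure \<mu> s) F"
proof -
  define d where "d = (\<integral>A. \<bar>det A\<bar> powr 1 \<partial>\<mu>)"
  have t1: "\<forall>\<^sub>F i in F. 1 < t i" using parameter s order_tendstoD(1)[of t s F 1] by simp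
  have low: "((\<lambda>i. \<integral>A. \<bar>det A\<bar> powr (t i / 2) \<partial>\<nu> i) \<longlongrightarrow> d) F"
    unfolding d_def using parameter s
    by (intro det_integral_tendsto) (auto intro!: tendsto_eq_intros)
  have up: "((\<lambda>i. \<integral>A. \<bar>det A\<bar> powr (t i - 1) \<partial>\<nu> i) \<longlongrightarrow> d) F"
    unfolding d_def using parameter s
    by (intro det_integral_tendsto) (auto intro!: tendsto_eq_intros)
  have iff: "ereal (ln c) \<le> pressure \<mu> s \<longleftrightarrow> c \<le> d" if "0 < c" for c
    using \<mu>.pressure_ge_2[of s] s that by (simp add: ln_le_ln_ext_iff d_def)
  show ?thesis
  proof (rule ereal_tendsto_by_log_levels)
    fix c c' :: real assume c: "0 < c" "c < c'" "ereal (ln c') \<le> pressure \<mu> s"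
    then have "c < d" using iff[of c'] by simp
    from order_tendstoD(1)[OF low this] t1 t2 contractive
    show "\<forall>\<^sub>F i in F. ereal (ln c) \<le> pressure (\<nu> i) (t i)"
    proof eventually_elim
      case (elim i)
      interpret contractive_measure "\<nu> i" by (rule elim)
      define D where "D = (\<integral>A. \<bar>det A\<bar> powr (t i / 2) \<partial>\<nu> i)"
      have w: "multiplicative_weight (\<lambda>A. \<bar>det A\<bar> powr (t i - 1))"
        using elim by (intro det_powr_multiplicative_weight) auto
      interpret W: contractive_moments "det_weighted (\<nu> i) (t i - 1)" "2 - t i"
        using elim by (simp add: contractive_moments_def contractive_moments_axioms_def contractive_det_weighted)
      have "c ^ n \<le> W.b n" for n
      proof -
        have "ennreal (c ^ n) \<le> ennreal (D ^ n)"
          using elim(1) c by (intro ennreal_leI power_mono) (auto simp: D_def)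
        also have "\<dots> = (\<integral>\<^sup>+A. ennreal (\<bar>det A\<bar> powr (t i / 2)) \<partial>product_law (\<nu> i) n)"
          unfolding D_def using elim by (intro nn_integral_word_det[symmetric]) auto
        also have "\<dots> \<le> (\<integral>\<^sup>+A. ennreal (svf (t i) A) \<partial>product_law (\<nu> i) n)"
          using elim by (intro nn_integral_mono ennreal_leI det_powr_le_svf) auto
        also have "\<dots> \<le> ennreal (W.b n)"
          using elim by (intro nn_integral_svf_bounds(2)[OF w] svf_between) auto
        finally show ?thesis using W.basis_moment_nonneg by simp
      qed
      then show ?case
        using pressure_between_1_2(2)[of "t i" c] elim c by (simp add: growth_at_least_def)
    qed
  next
    fix c :: real assume c: "0 < c" "pressure \<mu> s < ereal (ln c)"
    then have "d < c" using iff[of c] by (simp add: not_le[symmetric])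
    from order_tendstoD(2)[OF up this] t1 t2 contractive
    show "\<forall>\<^sub>F i in F. pressure (\<nu> i) (t i) \<le> ereal (ln c)"
    proof eventually_elim
      case (elim i)
      interpret contractive_measure "\<nu> i" by (rule elim)
      interpret W: contractive_moments "det_weighted (\<nu> i) (t i - 1)" "2 - t i"
        using elim by (simp add: contractive_moments_def contractive_moments_axioms_def contractive_det_weighted)
      have "\<not> growth_at_least (det_weighted (\<nu> i) (t i - 1)) (2 - t i) c"
        using W.growth_le_mass[of c] c elim mass_det_weighted[of "t i - 1"] by auto
      then have "\<not> ereal (ln c) \<le> pressure (\<nu> i) (t i)"
        using pressure_between_1_2(2)[of "t i" c] elim c by simp
      then show ?case by (simp add: not_le)
    qed
  qed
qed

text \<open>The weights \<open>\<bar>det A\<bar>\<^sup>t\<^sup>-\<^sup>1\<close> do not converge uniformly for \<open>t \<rightarrow> 1\<close>. From above they are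
bounded by \<open>1\<close>, which compares with the unweighted measures. From below they exceed a \<^emph>\<open>fixed\<close>
weight \<open>\<bar>det A\<bar>\<^sup>p\<close> as soon as \<open>t - 1 \<le> p\<close>, and for fixed \<open>p\<close> the growth rates with exponent
\<open>2 - t \<rightarrow> 1\<close> converge. Finally \<open>p \<rightarrow> 0\<close> leads from \<open>\<bar>det A\<bar>\<^sup>p \<mu>\<close> to the invertible part of \<open>\<mu>\<close>,
whose growth rate is by hypothesis not smaller than that of \<open>\<mu>\<close>.\<close>

lemma pressure_tendsto_1_from_above:
  assumes s: "s = 1" and t1: "\<forall>\<^sub>F i in F. 1 < t i"
    and inv: "pressure \<mu> 1 \<le> pressure (invertible_part \<mu>) 1"
  shows "((\<lambda>i. pressure (\<nu> i) (t i)) \<longlongrightarrow> pressure \<mu> s) F"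
proof -
  interpret I: contractive_measure "invertible_part \<mu>" by (rule \<mu>.contractive_invertible_part)
  have t2: "\<forall>\<^sub>F i in F. t i < 2" using parameter s order_tendstoD(2)[of t s F 2] by simp
  have r: "((\<lambda>i. 2 - t i) \<longlongrightarrow> 1) F" using parameter s by (auto intro!: tendsto_eq_intros)
  have r1: "\<forall>\<^sub>F i in F. 2 - t i \<le> 1" using t1 by eventually_elim simp
  show ?thesis
  proof (rule ereal_tendsto_by_log_levels)
    fix c c' :: real assume c: "0 < c" "c < c'" "ereal (ln c') \<le> pressure \<mu> s"
    have g: "growth_at_least (invertible_part \<mu>) 1 c'"
      using order_trans[OF c(3)[unfolded s] inv] I.pressure_le_1(2)[of 1 c'] c by simp
    obtain c1 where c1: "c < c1" "c1 < c'" using dense c by blast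
    define p where "p k = 1 / real (Suc k)" for k
    have p: "p \<longlonglongrightarrow> 0" "\<And>k. 0 < p k"
      unfolding p_def using LIMSEQ_inverse_real_of_nat by (simp_all add: inverse_eq_divide)
    interpret K: converging_measures "\<lambda>k. det_weighted \<mu> (p k)" "invertible_part \<mu>" "\<lambda>_. 1" 1 sequentially
      using p \<mu>.det_weighted_to_invertible_part[OF p]
      by unfold_locales
        (auto simp: contractive_moments_def contractive_moments_axioms_def \<mu>.contractive_det_weighted
          I.contractive_measure_axioms)
    have "\<forall>\<^sub>F k in sequentially. growth_at_least (det_weighted \<mu> (p k)) 1 c1"
      by (rule K.growth_lower_semicontinuous[OF g]) (use c c1 in auto)
    then obtain k where k: "growth_at_least (det_weighted \<mu> (p k)) 1 c1"
      using eventually_happens by fastforce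
    interpret D: converging_measures "\<lambda>i. det_weighted (\<nu> i) (p k)" "det_weighted \<mu> (p k)" "\<lambda>i. 2 - t i" 1 F
      by (intro converging_measures_det_weighted tendsto_const p r r1) auto
    have "\<forall>\<^sub>F i in F. t i < 1 + p k" using parameter s p(2)[of k] by (intro order_tendstoD(2)) auto
    with D.growth_lower_semicontinuous[OF k c(1) c1(1)] t1 t2 contractive
    show "\<forall>\<^sub>F i in F. ereal (ln c) \<le> pressure (\<nu> i) (t i)"
    proof eventually_elim
      case (elim i)
      interpret contractive_measure "\<nu> i" by (rule elim)
      have "growth_at_least (det_weighted (\<nu> i) (t i - 1)) (2 - t i) c"
      proof (rule growth_weighted_mono[OF _ _ _ _ _ _ _ _ elim(1)])
        fix A assume A: "A \<in> op_ball"
        show "\<bar>det A\<bar> powr p k \<le> \<bar>det A\<bar> powr (t i - 1)"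
          using abs_det_le_1[OF A] elim by (intro powr_mono') auto
        show "\<bar>det A\<bar> powr (t i - 1) \<le> 1"
          using abs_det_le_1[OF A] elim by (intro powr_le1) auto
      qed (use elim p in \<open>auto intro: continuous_det_powr\<close>)
      then show ?case using pressure_between_1_2(2)[of "t i" c] elim c by simp
    qed
  next
    fix c :: real assume c: "0 < c" "pressure \<mu> s < ereal (ln c)"
    then have ng: "\<not> growth_at_least \<mu> 1 c"
      using \<mu>.pressure_le_1(2)[of 1 c] s by (simp add: not_le[symmetric])
    interpret D: converging_measures \<nu> \<mu> "\<lambda>i. 2 - t i" 1 F
      by (intro converging_measures_unweighted r r1) auto
    from D.growth_upper_semicontinuous[OF ng] t1 t2 contractive
    show "\<forall>\<^sub>F i in F. pressure (\<nu> i) (t i) \<le> ereal (ln c)"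
    proof eventually_elim
      case (elim i)
      interpret contractive_measure "\<nu> i" by (rule elim)
      have "\<not> growth_at_least (det_weighted (\<nu> i) (t i - 1)) (2 - t i) c"
      proof
        assume g: "growth_at_least (det_weighted (\<nu> i) (t i - 1)) (2 - t i) c"
        have "growth_at_least (weighted (\<nu> i) (\<lambda>_. 1)) (2 - t i) c"
        proof (rule growth_weighted_mono[OF _ _ _ _ _ _ _ _ g])
          fix A assume A: "A \<in> op_ball"
          show "\<bar>det A\<bar> powr (t i - 1) \<le> 1"
            using abs_det_le_1[OF A] elim by (intro powr_le1) auto
        qed (use elim in \<open>auto intro: continuous_det_powr\<close>)
        then show False using elim(1) by (simp add: weighted_def density_1)
      qed
      then have "\<not> ereal (ln c) \<le> pressure (\<nu> i) (t i)"
        using pressure_between_1_2(2)[of "t i" c] elim c by simp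
      then show ?case by (simp add: not_le)
    qed
  qed
qed

lemma pressure_tendsto:
  assumes "s \<noteq> 1 \<or> pressure \<mu> 1 \<le> pressure (invertible_part \<mu>) 1"
  shows "((\<lambda>i. pressure (\<nu> i) (t i)) \<longlongrightarrow> pressure \<mu> s) F"
proof -
  consider "s < 1" | "s = 1" | "1 < s" "s < 2" | "s = 2" | "2 < s" by linarith
  then show ?thesis
  proof cases
    case 1
    have "\<forall>\<^sub>F i in F. t i < 1" using parameter 1 by (rule order_tendstoD)
    then have "\<forall>\<^sub>F i in F. t i \<le> 1" by eventually_elim simp
    then show ?thesis using 1 by (intro pressure_tendsto_le_1) auto
  next
    case 2
    show ?thesis
      by (rule tendsto_split[where Q = "\<lambda>i. t i \<le> 1"];
          rule converging_pairs.pressure_tendsto_le_1[OF restrict] converging_pairs.pressure_tendsto_1_from_above[OF restrict])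
        (use 2 assms in \<open>auto simp: eventually_inf_principal not_le\<close>)
  next
    case 3
    then show ?thesis by (rule pressure_tendsto_between_1_2)
  next
    case 4
    show ?thesis
      by (rule tendsto_split[where Q = "\<lambda>i. 2 \<le> t i"];
          rule converging_pairs.pressure_tendsto_ge_2[OF restrict] converging_pairs.pressure_tendsto_2_from_below[OF restrict])
        (use 4 in \<open>auto simp: eventually_inf_principal not_le\<close>)
  next
    case 5
    have "\<forall>\<^sub>F i in F. 2 < t i" using parameter 5 by (rule order_tendstoD)
    then have "\<forall>\<^sub>F i in F. 2 \<le> t i" by eventually_elim simp
    then show ?thesis using 5 by (intro pressure_tendsto_ge_2) auto
  qed
qed

end

lemma (in contractive_measure) pressure_less_infinity:
  assumes "0 < t"
  shows "pressure N t < \<infinity>"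
proof -
  consider "t \<le> 1" | "1 < t" "t < 2" | "2 \<le> t" by linarith
  then show ?thesis
  proof cases
    case 1
    then show ?thesis using pressure_le_1(1) assms by blast
  next
    case 2
    then show ?thesis using pressure_between_1_2(1) by blast
  next
    case 3
    then show ?thesis by (simp add: pressure_ge_2 ln_ext_def)
  qed
qed

section \<open>The discontinuities of the pressure\<close>

lemma contractive_ball_measure:
  assumes "\<mu> \<in> ball_measures"
  shows "contractive_measure \<mu>"
proof -
  have sets: "sets \<mu> = sets borel" and prob: "prob_space \<mu>" and ball: "emeasure \<mu> op_ball = 1"
    using assms by (auto simp: ball_measures_def)
  interpret prob_space \<mu> by (rule prob)
  have m: "op_ball \<in> sets \<mu>" using compact_op_ball sets by (simp add: borel_compact)
  have "prob op_ball = 1" using ball by (simp add: measure_def)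
  then have "AE A in \<mu>. A \<in> op_ball" using prob_eq_1[OF m] by simp
  then show ?thesis
    using sets prob_space by unfold_locales auto
qed

lemma set_integral_ball_measure:
  fixes h :: "mat2 \<Rightarrow> real"
  assumes "\<mu> \<in> ball_measures" "continuous_on UNIV h"
  shows "(LINT A:op_ball|\<mu>. h A) = integral\<^sup>L \<mu> h"
proof -
  interpret contractive_measure \<mu> by (rule contractive_ball_measure[OF assms(1)])
  have "op_ball \<in> sets \<mu>" using compact_op_ball sets_N by (simp add: borel_compact)
  then have "(\<lambda>A. indicat_real op_ball A *\<^sub>R h A) \<in> borel_measurable \<mu>"
    using continuous_measurable[OF assms(2)] by measurable
  then show ?thesis
    unfolding set_lebesgue_integral_def
    using AE_op_ball continuous_measurable[OF assms(2)] by (intro integral_cong_AE) (auto elim: eventually_mono)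
qed

abbreviation parameter_space :: "(mat2 measure \<times> real) topology" where
  "parameter_space \<equiv> prod_topology weak_star (top_of_set {0<..})"

text \<open>The integral over the ball of a function that is continuous on the whole matrix space is
continuous by definition of the weak-star topology, and for a measure carried by the ball it is
the full integral.\<close>

lemma converging_pairs_nhdsin:
  assumes "\<mu> \<in> ball_measures" "0 < s"
  shows "converging_pairs fst \<mu> snd s (nhdsin parameter_space (\<mu>, s))"
proof (rule converging_pairs.intro)
  have top: "(\<mu>, s) \<in> topspace parameter_space" using assms by (simp add: topspace_weak_star)
  have openI: "\<forall>\<^sub>F x in nhdsin parameter_space (\<mu>, s). Q x"
    if "openin weak_star U" "open V" "\<mu> \<in> U" "s \<in> V" "\<And>\<nu> t. \<nu> \<in> U \<Longrightarrow> t \<in> V \<Longrightarrow> 0 < t \<Longrightarrow> Q (\<nu>, t)" for U V Q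
  proof -
    have "openin parameter_space (U \<times> ({0<..} \<inter> V))"
      using that by (auto simp: openin_prod_Times_iff openin_open_Int)
    then show ?thesis
      unfolding eventually_nhdsin using that assms
      by (intro disjI2 exI[of _ "U \<times> ({0<..} \<inter> V)"]) auto
  qed
  have open_top: "openin weak_star ball_measures"
    using openin_topspace[of weak_star] by (simp add: topspace_weak_star)
  show "\<forall>\<^sub>F x in nhdsin parameter_space (\<mu>, s). contractive_measure (fst x)"
    using assms contractive_ball_measure by (intro openI[OF open_top open_UNIV]) auto
  show "contractive_measure \<mu>" using assms contractive_ball_measure by blast
  show "weakly_convergent fst \<mu> (nhdsin parameter_space (\<mu>, s))"
    unfolding weakly_convergent_def
  proof (intro allI impI topological_tendstoI)
    fix h :: "mat2 \<Rightarrow> real" and S :: "real set"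
    assume h: "continuous_on UNIV h" and S: "open S" "integral\<^sup>L \<mu> h \<in> S"
    have "openin weak_star {\<nu> \<in> ball_measures. (LINT A:op_ball|\<nu>. h A) \<in> S}"
      unfolding weak_star_def
      by (rule topology_generated_by_Basis) (use S continuous_on_subset[OF h] in blast)
    then show "\<forall>\<^sub>F x in nhdsin parameter_space (\<mu>, s). integral\<^sup>L (fst x) h \<in> S"
      by (rule openI[OF _ open_UNIV]) (use assms S in \<open>auto simp: set_integral_ball_measure h\<close>)
  qed
  show "(snd \<longlongrightarrow> s) (nhdsin parameter_space (\<mu>, s))"
  proof (rule topological_tendstoI)
    fix S :: "real set" assume "open S" "s \<in> S"
    then show "\<forall>\<^sub>F x in nhdsin parameter_space (\<mu>, s). snd x \<in> S"
      using assms by (intro openI[OF open_top]) auto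
  qed
qed (rule assms)

lemma topcontinuous_at_pressure_iff:
  assumes "\<mu> \<in> ball_measures" "0 < s"
  shows "topcontinuous_at parameter_space (top_of_set {-\<infinity>..<\<infinity>}) (\<lambda>(\<nu>, t). pressure \<nu> t) (\<mu>, s)
    \<longleftrightarrow> ((\<lambda>x. pressure (fst x) (snd x)) \<longlongrightarrow> pressure \<mu> s) (nhdsin parameter_space (\<mu>, s))"
    (is "?C \<longleftrightarrow> ?T")
proof -
  have fin: "pressure \<nu> t < \<infinity>" if "\<nu> \<in> ball_measures" "0 < t" for \<nu> t
    using contractive_measure.pressure_less_infinity contractive_ball_measure that by blast
  have top: "(\<mu>, s) \<in> topspace parameter_space" using assms by (simp add: topspace_weak_star)
  have "{-\<infinity>..<\<infinity>} = {..<\<infinity>::ereal}" by auto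
  then have "open {-\<infinity>..<\<infinity>::ereal}" by simp
  then have openin: "openin (top_of_set {-\<infinity>..<\<infinity>::ereal}) V \<longleftrightarrow> open V \<and> V \<subseteq> {-\<infinity>..<\<infinity>}" for V
    by (rule openin_open_eq)
  show ?thesis
  proof
    assume C: ?C
    show ?T
    proof (rule topological_tendstoI)
      fix V assume V: "open V" "pressure \<mu> s \<in> V"
      have "openin (top_of_set {-\<infinity>..<\<infinity>}) (V \<inter> {-\<infinity>..<\<infinity>})"
        using V \<open>open {-\<infinity>..<\<infinity>::ereal}\<close> by (simp add: openin open_Int)
      moreover have "pressure \<mu> s \<in> V \<inter> {-\<infinity>..<\<infinity>}" using V fin[OF assms] by simp
      ultimately obtain U where "openin parameter_space U" "(\<mu>, s) \<in> U"
        "\<forall>y\<in>U. (case y of (\<nu>, t) \<Rightarrow> pressure \<nu> t) \<in> V \<inter> {-\<infinity>..<\<infinity>}"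
        using C unfolding topcontinuous_at_def by (metis (mono_tags, lifting) case_prod_conv)
      then show "\<forall>\<^sub>F x in nhdsin parameter_space (\<mu>, s). pressure (fst x) (snd x) \<in> V"
        unfolding eventually_nhdsin by (auto simp: case_prod_beta)
    qed
  next
    assume T: ?T
    show ?C
      unfolding topcontinuous_at_def
    proof (intro conjI allI impI top)
      show "(\<lambda>(\<nu>, t). pressure \<nu> t) \<in> topspace parameter_space \<rightarrow> topspace (top_of_set {-\<infinity>..<\<infinity>})"
        using fin by (auto simp: topspace_weak_star)
      fix V :: "ereal set"
      assume "openin (top_of_set {-\<infinity>..<\<infinity>}) V \<and> (case (\<mu>, s) of (\<nu>, t) \<Rightarrow> pressure \<nu> t) \<in> V"
      then have "\<forall>\<^sub>F x in nhdsin parameter_space (\<mu>, s). pressure (fst x) (snd x) \<in> V"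
        using T by (auto simp: openin intro: topological_tendstoD)
      then show "\<exists>U. openin parameter_space U \<and> (\<mu>, s) \<in> U \<and> (\<forall>y\<in>U. (case y of (\<nu>, t) \<Rightarrow> pressure \<nu> t) \<in> V)"
        unfolding eventually_nhdsin using top by (auto simp: case_prod_beta)
    qed
  qed
qed

lemma filterlim_fixed_measure:
  assumes \<mu>: "\<mu> \<in> ball_measures" and t: "t \<longlonglongrightarrow> s" "0 < s"
  shows "filterlim (\<lambda>k. (\<mu>, t k)) (nhdsin parameter_space (\<mu>, s)) sequentially"
  unfolding filterlim_iff
proof (intro allI impI)
  fix Q assume "eventually Q (nhdsin parameter_space (\<mu>, s))"
  then obtain S where S: "openin parameter_space S" "(\<mu>, s) \<in> S" "\<And>x. x \<in> S \<Longrightarrow> Q x"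
    using assms by (auto simp: eventually_nhdsin topspace_weak_star)
  obtain U V where UV: "\<mu> \<in> U" "openin (top_of_set {0<..}) V" "s \<in> V" "U \<times> V \<subseteq> S"
    using S(1)[unfolded openin_prod_topology_alt, rule_format, OF S(2)] by blast
  have "open V" using UV(2) by (simp add: openin_open_eq)
  then have "\<forall>\<^sub>F k in sequentially. t k \<in> V" using t(1) UV(3) by (intro topological_tendstoD)
  then show "\<forall>\<^sub>F k in sequentially. Q (\<mu>, t k)"
    by eventually_elim (use UV S(3) in blast)
qed

text \<open>The jump is visible at the fixed measure \<open>\<mu>\<close> along \<open>s = 1 + p \<rightarrow> 1\<close> with \<open>p > 0\<close>: the
measures \<open>\<bar>det A\<bar>\<^sup>p \<mu>\<close> converge to the invertible part, so by upper semicontinuity of the growth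
rate the pressure eventually stays below any level above \<open>P(\<mu>\<^sup>0, 1)\<close>.\<close>

lemma pressure_not_tendsto:
  assumes \<mu>: "\<mu> \<in> ball_measures" and less: "pressure (invertible_part \<mu>) 1 < pressure \<mu> 1"
  shows "\<not> ((\<lambda>x. pressure (fst x) (snd x)) \<longlongrightarrow> pressure \<mu> 1) (nhdsin parameter_space (\<mu>, 1))"
proof
  assume T: "((\<lambda>x. pressure (fst x) (snd x)) \<longlongrightarrow> pressure \<mu> 1) (nhdsin parameter_space (\<mu>, 1))"
  interpret contractive_measure \<mu> by (rule contractive_ball_measure[OF \<mu>])
  interpret I: contractive_measure "invertible_part \<mu>" by (rule contractive_invertible_part)
  obtain y where y: "pressure (invertible_part \<mu>) 1 < ereal y" "ereal y < pressure \<mu> 1"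
    using less ereal_dense2 by blast
  define p where "p k = 1 / (real k + 2)" for k
  have p0: "p \<longlonglongrightarrow> 0" unfolding p_def by real_asymp
  have p: "0 < p k" "p k < 1" for k by (auto simp: p_def)
  interpret K: converging_measures "\<lambda>k. det_weighted \<mu> (p k)" "invertible_part \<mu>" "\<lambda>k. 1 - p k" 1 sequentially
    using p p0 det_weighted_to_invertible_part[OF p0 p(1)]
    by unfold_locales
      (auto simp: contractive_moments_def contractive_moments_axioms_def contractive_det_weighted
        I.contractive_measure_axioms less_imp_le intro!: tendsto_eq_intros)
  have "\<not> growth_at_least (invertible_part \<mu>) 1 (exp y)"
    using y I.pressure_le_1(2)[of 1 "exp y"] by (simp add: not_le[symmetric])
  then have "\<forall>\<^sub>F k in sequentially. \<not> growth_at_least (det_weighted \<mu> (p k)) (1 - p k) (exp y)"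
    by (rule K.growth_upper_semicontinuous)
  moreover have "\<forall>\<^sub>F k in sequentially. ereal y < pressure \<mu> (1 + p k)"
  proof -
    have "(\<lambda>k. 1 + p k) \<longlonglongrightarrow> 1" using p0 by (auto intro!: tendsto_eq_intros)
    from filterlim_compose[OF T filterlim_fixed_measure[OF \<mu> this]]
    have "(\<lambda>k. pressure \<mu> (1 + p k)) \<longlonglongrightarrow> pressure \<mu> 1" by simp
    then show ?thesis using y(2) by (rule order_tendstoD)
  qed
  ultimately have "\<forall>\<^sub>F k in sequentially. False"
  proof eventually_elim
    case (elim k)
    then show False
      using pressure_between_1_2(2)[of "1 + p k" "exp y"] p[of k] by (simp add: less_imp_le)
  qed
  then show False by simp
qed

theorem theorem2p4:
  fixes \<mu> :: "mat2 measure" and s :: real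
  assumes "\<mu> \<in> ball_measures" and "0 < s"
  shows "\<not> topcontinuous_at
            (prod_topology weak_star (top_of_set {0<..}))
            (top_of_set {-\<infinity>..<\<infinity>})
            (\<lambda>(\<nu>, t). pressure \<nu> t) (\<mu>, s)
         \<longleftrightarrow> s = 1 \<and> pressure \<mu> 1 > pressure (invertible_part \<mu>) 1"
proof -
  interpret converging_pairs fst \<mu> snd s "nhdsin parameter_space (\<mu>, s)"
    by (rule converging_pairs_nhdsin[OF assms])
  show ?thesis
    unfolding topcontinuous_at_pressure_iff[OF assms]
  proof
    assume "\<not> ((\<lambda>x. pressure (fst x) (snd x)) \<longlongrightarrow> pressure \<mu> s) (nhdsin parameter_space (\<mu>, s))"
    then have "\<not> (s \<noteq> 1 \<or> pressure \<mu> 1 \<le> pressure (invertible_part \<mu>) 1)"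
      using pressure_tendsto by blast
    then show "s = 1 \<and> pressure \<mu> 1 > pressure (invertible_part \<mu>) 1" by (simp add: not_le)
  next
    assume "s = 1 \<and> pressure \<mu> 1 > pressure (invertible_part \<mu>) 1"
    then show "\<not> ((\<lambda>x. pressure (fst x) (snd x)) \<longlongrightarrow> pressure \<mu> s) (nhdsin parameter_space (\<mu>, s))"
      using pressure_not_tendsto[OF assms(1)] by simp
  qed
qed

end
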